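(* For any $0<\epsilon\leq 1/11$, every $d$-regular $\epsilon$-spectral expander on $2n$ vertices has at least $(d/e)^n\left(\frac{\epsilon}{2e^3d^6}\right)^{\epsilon n}$ perfect matchings.
   Context: For a graph $G$ on $2n$ vertices with adjacency matrix $A$ and diagonal degree matrix $D$, the normalized adjacency matrix is $\tilde A=D^{-1/2}AD^{-1/2}$, with eigenvalues $\lambda_1\geq\dots\geq\lambda_{2n}$; set $\sigma_2(\tilde A)=\max\{\lambda_2,|\lambda_{2n}|\}$. For $0<\epsilon<1$, $G$ is an $\epsilon$-spectral expander if $\sigma_2(\tilde A)\leq\epsilon$. *)

theory Defs
  imports Complex_Main "Jordan_Normal_Form.Char_Poly"
begin

definition simple_graph :: "nat \<Rightarrow> (nat \<Rightarrow> nat \<Rightarrow> bool) \<Rightarrow> bool" where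
  "simple_graph N E \<longleftrightarrow>
     (\<forall>i j. E i j \<longrightarrow> i < N \<and> j < N) \<and> (\<forall>i j. E i j \<longrightarrow> E j i) \<and> (\<forall>i. \<not> E i i)"

definition degree :: "nat \<Rightarrow> (nat \<Rightarrow> nat \<Rightarrow> bool) \<Rightarrow> nat \<Rightarrow> nat" where
  "degree N E i = card {j. j < N \<and> E i j}"

definition regular :: "nat \<Rightarrow> (nat \<Rightarrow> nat \<Rightarrow> bool) \<Rightarrow> nat \<Rightarrow> bool" where
  "regular N E d \<longleftrightarrow> (\<forall>i<N. degree N E i = d)"

definition adj_matrix :: "nat \<Rightarrow> (nat \<Rightarrow> nat \<Rightarrow> bool) \<Rightarrow> real mat" where
  "adj_matrix N E = mat N N (\<lambda>(i, j). if E i j then 1 else 0)"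

definition deg_inv_sqrt_matrix :: "nat \<Rightarrow> (nat \<Rightarrow> nat \<Rightarrow> bool) \<Rightarrow> real mat" where
  "deg_inv_sqrt_matrix N E =
     mat N N (\<lambda>(i, j). if i = j then 1 / sqrt (real (degree N E i)) else 0)"

definition norm_adj_matrix :: "nat \<Rightarrow> (nat \<Rightarrow> nat \<Rightarrow> bool) \<Rightarrow> real mat" where
  "norm_adj_matrix N E =
     deg_inv_sqrt_matrix N E * adj_matrix N E * deg_inv_sqrt_matrix N E"

text \<open>Eigenvalues of a (real symmetric) matrix, listed with multiplicity in
  non-increasing order: entry k of the list is lambda_(k+1).\<close>
definition eigenvalues_desc :: "real mat \<Rightarrow> real list" where
  "eigenvalues_desc A = rev (sorted_list_of_multiset (proots (char_poly A)))"

definition sigma2 :: "nat \<Rightarrow> (nat \<Rightarrow> nat \<Rightarrow> bool) \<Rightarrow> real" where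
  "sigma2 N E = (let ev = eigenvalues_desc (norm_adj_matrix N E)
                 in max (ev ! 1) \<bar>ev ! (N - 1)\<bar>)"

definition spectral_expander :: "nat \<Rightarrow> (nat \<Rightarrow> nat \<Rightarrow> bool) \<Rightarrow> real \<Rightarrow> bool" where
  "spectral_expander N E \<epsilon> \<longleftrightarrow> sigma2 N E \<le> \<epsilon>"

definition edges :: "nat \<Rightarrow> (nat \<Rightarrow> nat \<Rightarrow> bool) \<Rightarrow> nat set set" where
  "edges N E = {{i, j} | i j. i < N \<and> j < N \<and> E i j}"

definition perfect_matching :: "nat \<Rightarrow> (nat \<Rightarrow> nat \<Rightarrow> bool) \<Rightarrow> nat set set \<Rightarrow> bool" where
  "perfect_matching N E M \<longleftrightarrow>
     M \<subseteq> edges N E \<and> (\<forall>v<N. \<exists>!e. e \<in> M \<and> v \<in> e)"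

definition num_perfect_matchings :: "nat \<Rightarrow> (nat \<Rightarrow> nat \<Rightarrow> bool) \<Rightarrow> nat" where
  "num_perfect_matchings N E = card {M. perfect_matching N E M}"

end

theory Submission
  imports Defs "Jordan_Normal_Form.Spectral_Radius" "HOL-Library.Discrete_Functions"
begin

text \<open>Let \<open>m\<^sub>j\<close> be the number of matchings leaving \<open>2 j\<close> vertices uncovered. As long as
  \<open>j > \<epsilon> n\<close>, the expander mixing lemma provides about \<open>d j (j - \<epsilon> n) / n\<close> edges between uncovered
  vertices, so adding edges one at a time bounds \<open>m\<^sub>q\<close> for \<open>q = \<lfloor>\<epsilon> n\<rfloor>\<close> from below by
  \<open>(d / e)\<^sup>n\<close> up to a factor of the permitted order. For \<open>1 \<le> j \<le> q\<close> let \<open>t\<close> be maximal with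
  \<open>2\<^sup>t j \<le> \<epsilon> n\<close>. Expansion lets the sets reachable by alternating paths from two halves of the
  uncovered vertices double \<open>t\<close> times, after which at least \<open>2 n / 11\<close> augmenting paths with
  \<open>2 t + 1\<close> matching edges connect them. A matching \<open>M'\<close> arises from at most \<open>2 n d\<^bsup>2 t + 1\<^esup>\<close>
  such augmentations, whence \<open>m\<^sub>j \<le> 11 d\<^bsup>2 t + 1\<^esup> m\<^bsub>j - 1\<^esub>\<close>, and the exponents add up to at
  most \<open>3 \<epsilon> n\<close>.\<close>

section \<open>The expander mixing lemma\<close>

text \<open>For an eigenvector \<open>v\<close>, the Hermitian form \<open>S\<close> is
  \<open>k\<close> times the squared norm \<open>r\<close> and, by symmetry, equals its own
  conjugate; \<open>r \<noteq> 0\<close> then forces \<open>cnj k = k\<close>.\<close>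

lemma symmetric_mat_eigenvalue_real:
  fixes A :: "real mat"
  assumes A: "A \<in> carrier_mat n n"
    and sym: "\<And>i j. i < n \<Longrightarrow> j < n \<Longrightarrow> A $$ (i, j) = A $$ (j, i)"
    and root: "poly (char_poly (map_mat complex_of_real A)) k = 0"
  shows "k \<in> \<real>"
proof -
  let ?C = "map_mat complex_of_real A"
  have C: "?C \<in> carrier_mat n n" using A by simp
  from root obtain v where v: "v \<in> carrier_vec n" "v \<noteq> 0\<^sub>v n" "?C *\<^sub>v v = k \<cdot>\<^sub>v v"
    using C by (auto simp: eigenvalue_root_char_poly[OF C, symmetric] eigenvalue_def eigenvector_def)
  have ev: "(\<Sum>j<n. of_real (A $$ (i, j)) * v $ j) = k * v $ i" if "i < n" for i
  proof -
    have "(?C *\<^sub>v v) $ i = k * v $ i" using v that by simp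
    moreover have "(?C *\<^sub>v v) $ i = (\<Sum>j<n. of_real (A $$ (i, j)) * v $ j)"
      using that A v(1) by (auto simp: scalar_prod_def atLeast0LessThan intro!: sum.cong)
    ultimately show ?thesis by simp
  qed
  define S where "S = (\<Sum>i<n. \<Sum>j<n. cnj (v $ i) * of_real (A $$ (i, j)) * v $ j)"
  define r where "r = (\<Sum>i<n. (cmod (v $ i))\<^sup>2)"
  have "S = (\<Sum>i<n. cnj (v $ i) * (k * v $ i))"
    unfolding S_def by (rule sum.cong) (simp_all add: ev[symmetric] sum_distrib_left mult.assoc)
  also have "\<dots> = k * of_real r"
    unfolding r_def of_real_sum sum_distrib_left
    by (rule sum.cong) (simp_all only: complex_norm_square mult_ac)
  finally have S: "S = k * of_real r" .
  have "cnj S = (\<Sum>i<n. \<Sum>j<n. v $ i * of_real (A $$ (i, j)) * cnj (v $ j))"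
    unfolding S_def by simp
  also have "\<dots> = (\<Sum>j<n. \<Sum>i<n. v $ i * of_real (A $$ (i, j)) * cnj (v $ j))"
    by (rule sum.swap)
  also have "\<dots> = S"
    unfolding S_def by (intro sum.cong) (auto simp: sym mult_ac)
  finally have "cnj k * of_real r = k * of_real r" using S by simp
  moreover have "r \<noteq> 0"
  proof
    assume "r = 0"
    then have "\<forall>i<n. v $ i = 0" unfolding r_def by (subst (asm) sum_nonneg_eq_0_iff) auto
    then have "v = 0\<^sub>v n" using v(1) by (intro eq_vecI) auto
    with v(2) show False by simp
  qed
  ultimately have "cnj k = k" by simp
  then show ?thesis by (simp add: Reals_cnj_iff)
qed

text \<open>\<open>proots\<close> sees only real roots, so this is what guarantees that
  \<open>eigenvalues_desc\<close> has full length and that its positions have their intended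
  meaning. All complex roots are real, hence the complex factorization descends to the
  reals.\<close>

lemma size_proots_symmetric_mat:
  fixes A :: "real mat"
  assumes A: "A \<in> carrier_mat n n"
    and sym: "\<And>i j. i < n \<Longrightarrow> j < n \<Longrightarrow> A $$ (i, j) = A $$ (j, i)"
  shows "size (proots (char_poly A)) = n"
proof -
  let ?C = "map_mat complex_of_real A"
  have C: "?C \<in> carrier_mat n n" using A by simp
  obtain as where as: "char_poly ?C = (\<Prod>a\<leftarrow>as. [:- a, 1:])" "length as = n"
    using char_poly_factorized[OF C] by blast
  have "a \<in> \<real>" if "a \<in> set as" for a
    by (rule symmetric_mat_eigenvalue_real[OF A sym])
       (use that in \<open>auto simp: as(1) poly_prod_list prod_list_zero_iff\<close>)
  then have re: "map (\<lambda>a. complex_of_real (Re a)) as = as"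
    by (intro map_idI) (simp add: of_real_Re)
  interpret h: map_poly_inj_idom_hom complex_of_real ..
  have "map_poly complex_of_real (\<Prod>a\<leftarrow>as. [:- Re a, 1:]) = (\<Prod>a\<leftarrow>as. [:- of_real (Re a), 1:])"
    by (simp add: h.hom_prod_list o_def)
  also have "\<dots> = (\<Prod>a\<leftarrow>map (\<lambda>a. complex_of_real (Re a)) as. [:- a, 1:])" by (simp add: o_def)
  also have "\<dots> = map_poly complex_of_real (char_poly A)"
    unfolding re as(1)[symmetric] by (rule of_real_hom.char_poly_hom[OF A])
  finally have "char_poly A = (\<Prod>p\<leftarrow>map (\<lambda>a. [:- Re a, 1:]) as. p)"
    by (simp add: h.eq_iff)
  then have "proots (char_poly A) = proots (\<Prod>p\<leftarrow>map (\<lambda>a. [:- Re a, 1:]) as. p)" by simp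
  also have "\<dots> = (\<Sum>a\<leftarrow>as. {#Re a#})"
    by (subst proots_prod_list) (auto simp: o_def)
  also have "size \<dots> = length as" by (induction as) auto
  finally show ?thesis using as(2) by simp
qed

section \<open>Removing the trivial eigenvalue\<close>

lemma index_mult_mat_sum:
  assumes "A \<in> carrier_mat n m" "B \<in> carrier_mat m p" "i < n" "j < p"
  shows "(A * B) $$ (i, j) = (\<Sum>k<m. A $$ (i, k) * B $$ (k, j))"
  using assms by (auto simp: scalar_prod_def atLeast0LessThan)

text \<open>The products \<open>?L * ?X\<close> and \<open>?X * ?R\<close> are the same block
  matrix, and every factor is block triangular, so comparing determinants gives the claim.\<close>

lemma det_one_plus_rank_one:
  fixes U V :: "'a :: idom mat"
  assumes U: "U \<in> carrier_mat n 1" and V: "V \<in> carrier_mat 1 n"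
  shows "det (1\<^sub>m n + U * V) = 1 + (V * U) $$ (0, 0)"
proof -
  let ?L = "four_block_mat (1\<^sub>m n + U * V) U (0\<^sub>m 1 n) (1\<^sub>m 1)"
  let ?X = "four_block_mat (1\<^sub>m n) (0\<^sub>m n 1) (- V) (1\<^sub>m 1)"
  let ?R = "four_block_mat (1\<^sub>m n) U (0\<^sub>m 1 n) (1\<^sub>m 1 + V * U)"
  have LC: "?L \<in> carrier_mat (n + 1) (n + 1)" and XC: "?X \<in> carrier_mat (n + 1) (n + 1)"
    and RC: "?R \<in> carrier_mat (n + 1) (n + 1)"
    using U V by auto
  have UV: "U * V \<in> carrier_mat n n" and VU: "V * U \<in> carrier_mat 1 1" using U V by auto
  have "?L * ?X = four_block_mat (1\<^sub>m n) U (- V) (1\<^sub>m 1)"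
    by (subst mult_four_block_mat[of _ n n _ 1 _ 1 _ _ n _ 1])
       (use U V UV in \<open>auto intro!: arg_cong2[where f = "\<lambda>a b. four_block_mat a U b (1\<^sub>m 1)"]\<close>)
  moreover have "?X * ?R = four_block_mat (1\<^sub>m n) U (- V) (1\<^sub>m 1)"
    by (subst mult_four_block_mat[of _ n n _ 1 _ 1 _ _ n _ 1])
       (use U V VU in \<open>auto intro!: arg_cong[where f = "\<lambda>a. four_block_mat (1\<^sub>m n) U (- V) a"]\<close>)
  ultimately have "det ?L * det ?X = det ?X * det ?R"
    using det_mult[OF LC XC] det_mult[OF XC RC] by simp
  moreover have "det ?L = det (1\<^sub>m n + U * V)"
    by (subst det_four_block_mat_lower_left_zero[of _ n _ 1]) (use U V UV in auto)
  moreover have "det ?X = 1"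
    by (subst det_four_block_mat_upper_right_zero[of _ n _ 1]) (use U V in auto)
  moreover have "det ?R = det (1\<^sub>m 1 + V * U)"
    by (subst det_four_block_mat_lower_left_zero[of _ n _ 1]) (use U V VU in auto)
  moreover have "det (1\<^sub>m 1 + V * U) = 1 + (V * U) $$ (0, 0)"
    using VU U V by (subst det_single) auto
  ultimately show ?thesis by simp
qed

text \<open>The determinant computation below divides by \<open>k - 1\<close> and therefore says
  nothing at the point 1.\<close>

lemma poly_eqI_except_point:
  fixes p q :: "real poly"
  assumes "\<And>x. x \<noteq> c \<Longrightarrow> poly p x = poly q x"
  shows "p = q"
proof (rule ccontr)
  assume "p \<noteq> q"
  then have "finite {x. poly (p - q) x = 0}" by (intro poly_roots_finite) simp
  moreover have "UNIV - {c} \<subseteq> {x. poly (p - q) x = 0}" using assms by auto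
  ultimately have "finite (UNIV - {c})" by (rule rev_finite_subset)
  then show False by (simp add: infinite_UNIV_char_0)
qed

text \<open>The all-ones vector has eigenvalue 1, and subtracting the projection onto it turns one
  eigenvalue 1 into 0. The product form expresses this exchange of roots without a polynomial
  division.\<close>

lemma char_poly_deflate_ones:
  fixes A :: "real mat"
  assumes A: "A \<in> carrier_mat n n" and n: "n > 0"
    and rows: "\<And>i. i < n \<Longrightarrow> (\<Sum>j<n. A $$ (i, j)) = 1"
  defines "B \<equiv> mat n n (\<lambda>(i, j). A $$ (i, j) - 1 / real n)"
  shows "char_poly B * [:-1, 1:] = char_poly A * [:0, 1:]"
proof (rule poly_eqI_except_point[of 1])
  fix k :: real
  assume k: "k \<noteq> 1"
  define U where "U = mat n 1 (\<lambda>_. 1 / (k - 1))"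
  define V where "V = mat 1 n (\<lambda>_. 1 / real n)"
  have U: "U \<in> carrier_mat n 1" and V: "V \<in> carrier_mat 1 n" by (auto simp: U_def V_def)
  have B: "B \<in> carrier_mat n n" by (simp add: B_def)
  have UV: "U * V = mat n n (\<lambda>_. 1 / (real n * (k - 1)))"
    by (rule eq_matI) (auto simp: U_def V_def scalar_prod_def)
  have VU: "(V * U) $$ (0, 0) = 1 / (k - 1)"
    using n by (auto simp: U_def V_def scalar_prod_def)
  \<comment> \<open>Here \<open>- char_matrix A k\<close> is k - A. Row sums 1 give (k - A) J = (k -
    1) J for the all-ones matrix J, so the rank-one factor adds exactly J / n.\<close>
  have "- char_matrix A k * (1\<^sub>m n + U * V) = - char_matrix B k"
  proof (rule eq_matI, goal_cases)
    case (1 i j)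
    then have ij: "i < n" "j < n" using carrier_matD[OF char_matrix_closed[OF B, of k]] by auto
    define c where "c = 1 / (real n * (k - 1))"
    have "(- char_matrix A k * (1\<^sub>m n + U * V)) $$ (i, j)
        = (\<Sum>l<n. (- char_matrix A k) $$ (i, l) * (1\<^sub>m n + U * V) $$ (l, j))"
      by (rule index_mult_mat_sum[of _ n]) (use A U V ij in auto)
    also have "\<dots> = (\<Sum>l<n. ((if i = l then k else 0) - A $$ (i, l)) * ((if l = j then 1 else 0) + c))"
      unfolding UV c_def[symmetric] using A ij by (intro sum.cong) (auto simp: char_matrix_def)
    also have "\<dots> = (\<Sum>l<n. (if l = j then (if i = l then k else 0) - A $$ (i, l) else 0)
         + c * (if i = l then k else 0) - c * A $$ (i, l))"
      by (rule sum.cong) (auto simp: algebra_simps)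
    also have "\<dots> = ((if i = j then k else 0) - A $$ (i, j)) + (c * k - c)"
      using ij rows[of i]
      by (simp add: sum.distrib sum_subtractf sum_distrib_left[symmetric])
    also have "c * k - c = 1 / real n" proof -
      have "c * k - c = c * (k - 1)" by (simp add: algebra_simps)
      then show ?thesis using k by (simp add: c_def)
    qed
    finally show ?case using ij A by (simp add: char_matrix_def B_def)
  qed (use A V carrier_matD[OF char_matrix_closed[OF A, of k]]
      carrier_matD[OF char_matrix_closed[OF B, of k]] in auto)
  then have "det (- char_matrix B k) = det (- char_matrix A k * (1\<^sub>m n + U * V))" by simp
  also have "\<dots> = det (- char_matrix A k) * det (1\<^sub>m n + U * V)"
    by (rule det_mult[of _ n]) (use A U V in auto)
  also have "\<dots> = det (- char_matrix A k) * (1 + 1 / (k - 1))"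
    by (simp add: det_one_plus_rank_one[OF U V] VU)
  finally have "poly (char_poly B) k = poly (char_poly A) k * (1 + 1 / (k - 1))"
    by (simp add: char_poly_matrix[OF A] char_poly_matrix[OF B])
  then show "poly (char_poly B * [:-1, 1:]) k = poly (char_poly A * [:0, 1:]) k"
    using k by (simp add: field_simps)
qed

text \<open>The eigenvalue 1 must be the first entry of the list and is the one that deflation
  replaces by 0; all others lie between the last entry and the second.\<close>

lemma deflated_root_bound:
  fixes A :: "real mat" and \<epsilon> :: real
  assumes A: "A \<in> carrier_mat n n" and n: "n \<ge> 2"
    and sym: "\<And>i j. i < n \<Longrightarrow> j < n \<Longrightarrow> A $$ (i, j) = A $$ (j, i)"
    and rows: "\<And>i. i < n \<Longrightarrow> (\<Sum>j<n. A $$ (i, j)) = 1"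
    and second: "eigenvalues_desc A ! 1 \<le> \<epsilon>"
    and least: "\<bar>eigenvalues_desc A ! (n - 1)\<bar> \<le> \<epsilon>"
    and \<epsilon>: "0 \<le> \<epsilon>" "\<epsilon> < 1"
  defines "B \<equiv> mat n n (\<lambda>(i, j). A $$ (i, j) - 1 / real n)"
  assumes r: "poly (char_poly B) r = 0"
  shows "\<bar>r\<bar> \<le> \<epsilon>"
proof -
  define ev where "ev = eigenvalues_desc A"
  have B: "B \<in> carrier_mat n n" by (simp add: B_def)
  have nz: "char_poly A \<noteq> 0" "char_poly B \<noteq> 0"
    using degree_monic_char_poly[OF A] degree_monic_char_poly[OF B] n by auto
  have ms: "mset ev = proots (char_poly A)"
    by (simp add: ev_def eigenvalues_desc_def)
  then have len: "length ev = n"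
    using size_proots_symmetric_mat[OF A sym] by (metis size_mset)
  have srt: "ev ! j \<le> ev ! i" if "i \<le> j" "j < n" for i j
  proof -
    have "sorted (rev ev)" by (simp add: ev_def eigenvalues_desc_def)
    then show ?thesis using that len by (simp add: sorted_rev_nth_mono)
  qed
  have "proots (char_poly B * [:-1, 1:]) = proots (char_poly A * [:0, 1:])"
    using char_poly_deflate_ones[OF A _ rows] n unfolding B_def by simp
  moreover have "proots (char_poly B * [:-1, 1:]) = proots (char_poly B) + proots [:-1, 1:]"
    by (rule proots_mult) (use nz in auto)
  moreover have "proots (char_poly A * [:0, 1:]) = proots (char_poly A) + proots [:0, 1:]"
    by (rule proots_mult) (use nz in auto)
  ultimately have eq: "proots (char_poly B) + {#1#} = mset ev + {#0#}"
    by (simp add: ms)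
  have rB: "r \<in># proots (char_poly B)" using r nz by simp
  show ?thesis
  proof (cases "r = 0")
    case True
    with \<epsilon> show ?thesis by simp
  next
    case False
    have one: "1 \<in># mset ev" using eq
      by (metis add_mset_add_single insert_noteq_member union_single_eq_member zero_neq_one)
    obtain e es where ev: "ev = e # es" using len n by (cases ev) auto
    have es: "x \<le> ev ! 1 \<and> ev ! (n - 1) \<le> x" if x: "x \<in> set es" for x
    proof -
      obtain i where i: "i < length es" "x = es ! i" using x by (auto simp: in_set_conv_nth)
      then have "x = ev ! (i + 1)" "i + 1 < n" using ev len by auto
      then show ?thesis using srt[of 1 "i + 1"] srt[of "i + 1" "n - 1"] by auto
    qed
    \<comment> \<open>An entry 1 in the tail would be at most
      \<open>ev ! 1 \<le> \<epsilon> < 1\<close>.\<close>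
    have "e = 1"
      using one es[of 1] second \<epsilon> unfolding ev_def[symmetric] by (auto simp: ev)
    then have "proots (char_poly B) = mset es + {#0#}" using eq by (simp add: ev)
    then have "r \<in> set es" using rB False by auto
    then show ?thesis using es[of r] second least unfolding ev_def[symmetric] by auto
  qed
qed

section \<open>From eigenvalue bounds to norm bounds\<close>

text \<open>Lagrange's identity: the two sides differ by half of a double sum of squares.\<close>

lemma sum_Cauchy_Schwarz:
  fixes a b :: "'a \<Rightarrow> real"
  shows "(\<Sum>i\<in>I. a i * b i)\<^sup>2 \<le> (\<Sum>i\<in>I. (a i)\<^sup>2) * (\<Sum>i\<in>I. (b i)\<^sup>2)"
proof -
  have "0 \<le> (\<Sum>i\<in>I. \<Sum>j\<in>I. (a i * b j - a j * b i)\<^sup>2)" by (intro sum_nonneg) auto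
  also have "\<dots> = (\<Sum>i\<in>I. \<Sum>j\<in>I. (a i)\<^sup>2 * (b j)\<^sup>2) + (\<Sum>i\<in>I. \<Sum>j\<in>I. (b i)\<^sup>2 * (a j)\<^sup>2)
      - 2 * (\<Sum>i\<in>I. \<Sum>j\<in>I. (a i * b i) * (a j * b j))"
    unfolding sum_distrib_left sum.distrib[symmetric] sum_subtractf[symmetric]
    by (intro sum.cong) (auto simp: power2_eq_square algebra_simps)
  also have "\<dots> = 2 * ((\<Sum>i\<in>I. (a i)\<^sup>2) * (\<Sum>i\<in>I. (b i)\<^sup>2)) - 2 * (\<Sum>i\<in>I. a i * b i)\<^sup>2"
    unfolding sum_product[symmetric] power2_eq_square[of "sum _ _"] by (simp add: mult.commute)
  finally show ?thesis by simp
qed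

definition mat_apply :: "nat \<Rightarrow> real mat \<Rightarrow> (nat \<Rightarrow> real) \<Rightarrow> nat \<Rightarrow> real" where
  "mat_apply n C g i = (\<Sum>j<n. C $$ (i, j) * g j)"

lemma mat_apply_funpow:
  assumes C: "C \<in> carrier_mat n n" and i: "i < n"
  shows "((mat_apply n C ^^ k) g) i = (\<Sum>j<n. (C ^\<^sub>m k) $$ (i, j) * g j)"
proof (induction k arbitrary: g)
  case 0
  have "(\<Sum>j<n. (C ^\<^sub>m 0) $$ (i, j) * g j) = (\<Sum>j<n. if j = i then g j else 0)"
    using C i by (intro sum.cong) auto
  then show ?case using i by simp
next
  case (Suc k)
  have Ck: "C ^\<^sub>m k \<in> carrier_mat n n" using C by simp
  have "((mat_apply n C ^^ Suc k) g) i = ((mat_apply n C ^^ k) (mat_apply n C g)) i"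
    by (simp add: funpow_swap1)
  also have "\<dots> = (\<Sum>l<n. \<Sum>j<n. (C ^\<^sub>m k) $$ (i, l) * C $$ (l, j) * g j)"
    by (simp add: Suc.IH mat_apply_def sum_distrib_left mult.assoc)
  also have "\<dots> = (\<Sum>j<n. \<Sum>l<n. (C ^\<^sub>m k) $$ (i, l) * C $$ (l, j) * g j)"
    by (rule sum.swap)
  also have "\<dots> = (\<Sum>j<n. (C ^\<^sub>m Suc k) $$ (i, j) * g j)"
    using C Ck i
    by (intro sum.cong)
       (auto simp: scalar_prod_def atLeast0LessThan sum_distrib_right simp del: pow_mat_dim_square)
  finally show ?case .
qed

text \<open>For a symmetric matrix, \<open>a m = \<langle>g, C\<^sup>m g\<rangle>\<close> satisfies \<open>(a m)\<^sup>2 \<le> a 0 * a (2 * m)\<close>;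
  if \<open>a 2 > a 0\<close> this makes \<open>a (2 ^ k)\<close> grow without bound.\<close>

lemma symmetric_power_bounded_contraction:
  fixes C :: "real mat"
  assumes C: "C \<in> carrier_mat n n"
    and sym: "\<And>i j. i < n \<Longrightarrow> j < n \<Longrightarrow> C $$ (i, j) = C $$ (j, i)"
    and bnd: "\<And>k. norm_bound (C ^\<^sub>m k) c"
  shows "(\<Sum>i<n. (mat_apply n C g i)\<^sup>2) \<le> (\<Sum>i<n. (g i)\<^sup>2)"
proof (rule ccontr)
  define w where "w k = (mat_apply n C ^^ k) g" for k
  define a where "a m = (\<Sum>i<n. w 0 i * w m i)" for m
  have shift: "(\<Sum>i<n. w (Suc k) i * w m i) = (\<Sum>i<n. w k i * w (Suc m) i)" for k m
  proof -
    have "(\<Sum>i<n. w (Suc k) i * w m i) = (\<Sum>i<n. \<Sum>j<n. C $$ (i, j) * w k j * w m i)"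
      by (simp add: w_def mat_apply_def sum_distrib_right)
    also have "\<dots> = (\<Sum>j<n. \<Sum>i<n. C $$ (i, j) * w k j * w m i)" by (rule sum.swap)
    also have "\<dots> = (\<Sum>j<n. \<Sum>i<n. w k j * (C $$ (j, i) * w m i))"
      by (intro sum.cong) (auto simp: sym mult_ac)
    also have "\<dots> = (\<Sum>j<n. w k j * w (Suc m) j)"
      by (simp add: w_def mat_apply_def sum_distrib_left)
    finally show ?thesis .
  qed
  \<comment> \<open>Moving applications of \<open>C\<close> across by \<open>shift\<close> makes the
    inner product depend on \<open>k + m\<close> only.\<close>
  have prod: "(\<Sum>i<n. w k i * w m i) = a (k + m)" for k m
    by (induction k arbitrary: m) (simp_all add: shift, simp add: a_def)
  have CS: "(a m)\<^sup>2 \<le> a 0 * a (m + m)" for m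
    using sum_Cauchy_Schwarz[of "w 0" "w m" "{..<n}"]
    by (simp add: prod power2_eq_square)
  have a0: "a 0 = (\<Sum>i<n. (g i)\<^sup>2)" by (simp add: a_def w_def power2_eq_square)
  have a2: "a 2 = (\<Sum>i<n. (mat_apply n C g i)\<^sup>2)"
    using prod[of 1 1] by (simp add: w_def power2_eq_square numeral_2_eq_2)
  assume "\<not> ?thesis"
  then have lt: "a 0 < a 2" by (simp add: a0 a2)
  have "a 0 \<ge> 0" unfolding a0 by (intro sum_nonneg) auto
  moreover have "a 0 \<noteq> 0" using CS[of 2] lt by auto
  ultimately have pos: "a 0 > 0" by simp
  define r where "r = a 2 / a 0"
  have r: "r > 1" using lt pos by (simp add: r_def)
  have grow: "a (2 ^ Suc k) \<ge> a 0 * r ^ (2 ^ k)" for k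
  proof (induction k)
    case 0
    then show ?case using pos by (simp add: r_def)
  next
    case (Suc k)
    have "(a 0 * r ^ (2 ^ k))\<^sup>2 \<le> (a (2 ^ Suc k))\<^sup>2"
      using Suc pos r by (intro power_mono) auto
    also have "\<dots> \<le> a 0 * a (2 ^ Suc (Suc k))" using CS[of "2 ^ Suc k"] by (simp add: mult_2)
    finally have "a 0 * (a 0 * (r ^ (2 ^ k))\<^sup>2) \<le> a 0 * a (2 ^ Suc (Suc k))"
      by (simp add: power2_eq_square mult_ac)
    then have "a 0 * (r ^ (2 ^ k))\<^sup>2 \<le> a (2 ^ Suc (Suc k))" using pos by simp
    then show ?case by (simp add: power_mult[symmetric] mult.commute)
  qed
  \<comment> \<open>The uniform entry bound \<open>c\<close> for all powers bounds every
    \<open>a m\<close> independently of \<open>m\<close>, contradicting \<open>grow\<close>.\<close>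
  define K where "K = (\<Sum>i<n. \<Sum>j<n. \<bar>g i\<bar> * (c * \<bar>g j\<bar>))"
  have bounded: "a m \<le> K" for m
  proof -
    have "a m = (\<Sum>i<n. g i * (\<Sum>j<n. (C ^\<^sub>m m) $$ (i, j) * g j))"
      unfolding a_def w_def by (intro sum.cong) (auto simp: mat_apply_funpow[OF C])
    also have "\<dots> = (\<Sum>i<n. \<Sum>j<n. g i * ((C ^\<^sub>m m) $$ (i, j) * g j))"
      by (simp add: sum_distrib_left)
    also have "\<dots> \<le> K"
      unfolding K_def
    proof (intro sum_mono)
      fix i j assume ij: "i \<in> {..<n}" "j \<in> {..<n}"
      have "\<bar>(C ^\<^sub>m m) $$ (i, j)\<bar> \<le> c"
        using bnd[of m] ij C unfolding norm_bound_def by simp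
      then have "\<bar>g i * ((C ^\<^sub>m m) $$ (i, j) * g j)\<bar> \<le> \<bar>g i\<bar> * (c * \<bar>g j\<bar>)"
        by (auto simp: abs_mult intro!: mult_left_mono mult_right_mono)
      then show "g i * ((C ^\<^sub>m m) $$ (i, j) * g j) \<le> \<bar>g i\<bar> * (c * \<bar>g j\<bar>)" by simp
    qed
    finally show ?thesis .
  qed
  obtain k where k: "K / a 0 < r ^ k" using real_arch_pow[OF r] by blast
  also have "r ^ k \<le> r ^ (2 ^ k)" using r by (intro power_increasing) (auto simp: less_imp_le)
  finally have "K < a 0 * r ^ (2 ^ k)" using pos by (simp add: field_simps)
  with grow[of k] bounded[of "2 ^ Suc k"] show False by simp
qed

text \<open>For each \<open>\<rho> > \<epsilon>\<close> the matrix \<open>B / \<rho>\<close> has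
  spectral radius below 1, hence bounded powers, hence does not increase norms. Letting
  \<open>\<rho>\<close> tend to \<open>\<epsilon>\<close> gives the bound without diagonalizing
  \<open>B\<close>.\<close>

lemma symmetric_mat_contraction:
  fixes B :: "real mat" and \<epsilon> :: real
  assumes B: "B \<in> carrier_mat n n" and n: "n > 0"
    and sym: "\<And>i j. i < n \<Longrightarrow> j < n \<Longrightarrow> B $$ (i, j) = B $$ (j, i)"
    and roots: "\<And>r. poly (char_poly B) r = 0 \<Longrightarrow> \<bar>r\<bar> \<le> \<epsilon>"
    and \<epsilon>: "0 \<le> \<epsilon>"
  shows "(\<Sum>i<n. (mat_apply n B g i)\<^sup>2) \<le> \<epsilon>\<^sup>2 * (\<Sum>i<n. (g i)\<^sup>2)"
proof -
  let ?S = "\<Sum>i<n. (mat_apply n B g i)\<^sup>2" and ?G = "\<Sum>i<n. (g i)\<^sup>2"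
  have scaled: "?S \<le> \<rho>\<^sup>2 * ?G" if \<rho>: "\<rho> > \<epsilon>" for \<rho>
  proof -
    define C where "C = (1 / \<rho>) \<cdot>\<^sub>m B"
    let ?C = "map_mat complex_of_real C" and ?B = "map_mat complex_of_real B"
    have \<rho>0: "\<rho> > 0" using \<rho> \<epsilon> by simp
    have C: "C \<in> carrier_mat n n" using B by (simp add: C_def)
    have cC: "?C \<in> carrier_mat n n" and cB: "?B \<in> carrier_mat n n" using B C by simp_all
    have BC: "?B = of_real \<rho> \<cdot>\<^sub>m ?C" using \<rho>0 B by (intro eq_matI) (auto simp: C_def)
    \<comment> \<open>An eigenvalue \<open>k\<close> scales to a root \<open>\<rho> * k\<close> for
      \<open>B\<close>, which is real by symmetry and thus within reach of
      \<open>roots\<close>.\<close>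
    have small: "norm k < 1" if k: "k \<in> spectrum ?C" for k
    proof -
      obtain v where v: "v \<in> carrier_vec n" "v \<noteq> 0\<^sub>v n" "?C *\<^sub>v v = k \<cdot>\<^sub>v v"
        using k C by (auto simp: spectrum_def eigenvalue_def eigenvector_def)
      have "?B *\<^sub>v v = of_real \<rho> \<cdot>\<^sub>v (?C *\<^sub>v v)"
        unfolding BC using cC v(1) by (intro eq_vecI) auto
      then have "?B *\<^sub>v v = (of_real \<rho> * k) \<cdot>\<^sub>v v" using v by (simp add: smult_smult_assoc)
      then have root: "poly (char_poly ?B) (of_real \<rho> * k) = 0"
        using v B unfolding eigenvalue_root_char_poly[OF cB, symmetric]
        by (auto simp: eigenvalue_def eigenvector_def)
      then have "of_real \<rho> * k \<in> \<real>"
        by (intro symmetric_mat_eigenvalue_real[OF B sym])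
      then obtain r where r: "of_real \<rho> * k = of_real r" by (auto simp: Reals_def)
      have "poly (map_poly complex_of_real (char_poly B)) (of_real r) = 0"
        using root unfolding of_real_hom.char_poly_hom[OF B] r .
      then have "poly (char_poly B) r = 0" by simp
      then have "\<bar>r\<bar> \<le> \<epsilon>" by (rule roots)
      moreover have "\<rho> * norm k = \<bar>r\<bar>"
        using arg_cong[OF r, of norm] \<rho>0 by (simp add: norm_mult)
      ultimately have "\<rho> * norm k < \<rho> * 1" using \<rho> by simp
      then show ?thesis using \<rho>0 by simp
    qed
    have "spectral_radius ?C < 1"
      using spectral_radius_mem_max(1)[OF cC n] small by auto
    then obtain c where c: "\<And>k. norm_bound (?C ^\<^sub>m k) c"
      using spectral_radius_jnf_norm_bound_less_1_upper_triangular[OF cC] by blast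
    have cp: "norm_bound (C ^\<^sub>m k) c" for k
      using c[of k] unfolding of_real_hom.mat_hom_pow[OF C, symmetric] norm_bound_def by simp
    have "(\<Sum>i<n. (mat_apply n C g i)\<^sup>2) \<le> ?G"
      by (rule symmetric_power_bounded_contraction[OF C _ cp])
         (use B sym in \<open>auto simp: C_def\<close>)
    moreover have "mat_apply n C g i = mat_apply n B g i / \<rho>" if "i < n" for i
      unfolding mat_apply_def sum_divide_distrib
      using B that by (intro sum.cong) (auto simp: C_def)
    ultimately have "?S / \<rho>\<^sup>2 \<le> ?G" by (simp add: power_divide sum_divide_distrib)
    then show ?thesis using \<rho>0 by (simp add: field_simps)
  qed
  have "(\<lambda>m. (\<epsilon> + inverse (real (Suc m)))\<^sup>2 * ?G) \<longlonglongrightarrow> (\<epsilon> + 0)\<^sup>2 * ?G"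
    by (intro tendsto_intros LIMSEQ_inverse_real_of_nat)
  then have "?S \<le> (\<epsilon> + 0)\<^sup>2 * ?G"
    by (rule LIMSEQ_le_const) (use scaled in \<open>auto\<close>)
  then show ?thesis by simp
qed

section \<open>The mixing lemma for regular expanders\<close>

locale regular_expander =
  fixes n d :: nat and E :: "nat \<Rightarrow> nat \<Rightarrow> bool" and \<epsilon> :: real
  assumes n_pos: "n \<ge> 1" and d_pos: "d \<ge> 1"
    and eps_pos: "0 < \<epsilon>" and eps_le: "\<epsilon> \<le> 1 / 11"
    and simple: "simple_graph (2 * n) E"
    and regular: "regular (2 * n) E d"
    and expander: "spectral_expander (2 * n) E \<epsilon>"
begin

abbreviation N :: nat where "N \<equiv> 2 * n"

lemma E_less: "E i j \<Longrightarrow> i < N" "E i j \<Longrightarrow> j < N"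
  and E_sym: "E i j \<Longrightarrow> E j i"
  and E_irrefl: "\<not> E i i"
  using simple unfolding simple_graph_def by blast+

lemma card_neighbours: "i < N \<Longrightarrow> card {j. E i j} = d"
proof -
  assume "i < N"
  moreover have "{j. j < N \<and> E i j} = {j. E i j}" using E_less by blast
  ultimately show ?thesis using regular by (metis regular_def Defs.degree_def)
qed

lemma finite_neighbours: "finite {j. E i j}"
  by (rule finite_subset[of _ "{..<N}"]) (use E_less in auto)

text \<open>Pairs are ordered, so \<open>edge_pairs S S\<close> counts each edge inside
  \<open>S\<close> twice; augmenting paths are directed lists and are counted in the same
  way.\<close>

definition edge_pairs :: "nat set \<Rightarrow> nat set \<Rightarrow> (nat \<times> nat) set" where
  "edge_pairs X Y = {(x, y). x \<in> X \<and> y \<in> Y \<and> E x y}"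

lemma norm_adj_carrier: "norm_adj_matrix N E \<in> carrier_mat N N"
  by (rule carrier_matI) (simp_all add: norm_adj_matrix_def deg_inv_sqrt_matrix_def adj_matrix_def)

lemma norm_adj_index:
  assumes "i < N" "j < N"
  shows "norm_adj_matrix N E $$ (i, j) = of_bool (E i j) / real d"
proof -
  let ?D = "deg_inv_sqrt_matrix N E" and ?A = "adj_matrix N E"
  have deg: "Defs.degree N E k = d" if "k < N" for k using regular that by (simp add: regular_def)
  have D: "?D \<in> carrier_mat N N" and A: "?A \<in> carrier_mat N N"
    by (simp_all add: deg_inv_sqrt_matrix_def adj_matrix_def)
  have Dij: "?D $$ (k, l) = (if k = l then 1 / sqrt d else 0)" if "k < N" "l < N" for k l
    using that by (simp add: deg_inv_sqrt_matrix_def deg)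
  have DA: "(?D * ?A) $$ (i, k) = of_bool (E i k) / sqrt d" if k: "k < N" for k
  proof -
    have "(?D * ?A) $$ (i, k) = (\<Sum>l<N. ?D $$ (i, l) * ?A $$ (l, k))"
      by (rule index_mult_mat_sum[OF D A assms(1) k])
    also have "\<dots> = (\<Sum>l<N. if l = i then of_bool (E l k) / sqrt d else 0)"
      using assms k
      by (intro sum.cong) (auto simp: deg_inv_sqrt_matrix_def adj_matrix_def deg)
    finally show ?thesis using assms by simp
  qed
  have "norm_adj_matrix N E $$ (i, j) = (\<Sum>k<N. (?D * ?A) $$ (i, k) * ?D $$ (k, j))"
    unfolding norm_adj_matrix_def
    by (rule index_mult_mat_sum[OF mult_carrier_mat[OF D A] D assms])
  also have "\<dots> = (\<Sum>k<N. if k = j then of_bool (E i k) / sqrt d * (1 / sqrt d) else 0)"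
    using assms by (intro sum.cong) (auto simp: DA Dij)
  also have "\<dots> = of_bool (E i j) / real d" using assms by simp
  finally show ?thesis .
qed

definition deflated :: "real mat" where
  "deflated = mat N N (\<lambda>(i, j). norm_adj_matrix N E $$ (i, j) - 1 / real N)"

lemma deflated_index:
  "i < N \<Longrightarrow> j < N \<Longrightarrow> deflated $$ (i, j) = of_bool (E i j) / real d - 1 / real N"
  by (simp add: deflated_def norm_adj_index)

lemma sum_norm_adj_row: "i < N \<Longrightarrow> (\<Sum>j<N. norm_adj_matrix N E $$ (i, j)) = 1"
proof -
  assume i: "i < N"
  have "(\<Sum>j<N. norm_adj_matrix N E $$ (i, j)) = (\<Sum>j<N. of_bool (E i j)) / real d"
    unfolding sum_divide_distrib using i by (intro sum.cong) (auto simp: norm_adj_index)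
  also have "(\<Sum>j<N. of_bool (E i j) :: real) = real (card {j. E i j})"
  proof -
    have "{..<N} \<inter> {j. E i j} = {j. E i j}" using E_less(2) by auto
    then show ?thesis by simp
  qed
  finally show ?thesis using card_neighbours[OF i] d_pos by simp
qed

lemma deflated_contraction:
  "(\<Sum>i<N. (mat_apply N deflated g i)\<^sup>2) \<le> \<epsilon>\<^sup>2 * (\<Sum>i<N. (g i)\<^sup>2)"
proof (rule symmetric_mat_contraction)
  show "deflated \<in> carrier_mat N N" "N > 0" using n_pos by (auto simp: deflated_def)
  show "deflated $$ (i, j) = deflated $$ (j, i)" if "i < N" "j < N" for i j
    using that E_sym by (auto simp: deflated_index)
  show "0 \<le> \<epsilon>" using eps_pos by simp
  have ev: "eigenvalues_desc (norm_adj_matrix N E) ! 1 \<le> \<epsilon>"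
    "\<bar>eigenvalues_desc (norm_adj_matrix N E) ! (N - 1)\<bar> \<le> \<epsilon>"
    using expander by (auto simp: spectral_expander_def sigma2_def Let_def)
  show "\<bar>r\<bar> \<le> \<epsilon>" if "poly (char_poly deflated) r = 0" for r
    using that unfolding deflated_def
  proof (rule deflated_root_bound[OF norm_adj_carrier _ _ _ ev, rotated -1])
    show "norm_adj_matrix N E $$ (i, j) = norm_adj_matrix N E $$ (j, i)" if "i < N" "j < N" for i j
      using that E_sym by (auto simp: norm_adj_index)
  qed (use n_pos eps_pos eps_le sum_norm_adj_row in auto)
qed

text \<open>The deviation of the edge count is the inner product of the centred indicator of
  \<open>X\<close> with \<open>deflated\<close> applied to that of \<open>Y\<close>; Cauchy-Schwarz
  and the contraction bound it. The factors on the right are the squared norms of the centred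
  indicators; keeping \<open>N - card Y\<close> pays off when \<open>Y\<close> is almost
  everything.\<close>

lemma expander_mixing:
  assumes X: "X \<subseteq> {..<N}" and Y: "Y \<subseteq> {..<N}"
  shows "(real (card (edge_pairs X Y)) / d - real (card X) * real (card Y) / N)\<^sup>2
    \<le> \<epsilon>\<^sup>2 * (card X * (real N - card X) / N) * (card Y * (real N - card Y) / N)"
proof -
  define g where "g Z i = of_bool (i \<in> Z) - real (card Z) / N" for Z and i :: nat
  define h where "h = mat_apply N deflated (g Y)"
  have N0: "real N > 0" using n_pos by simp
  have cardZ: "(\<Sum>i<N. of_bool (i \<in> Z)) = real (card Z)" if "Z \<subseteq> {..<N}" for Z
    using that by (simp add: sum_of_bool_eq) (metis inf.absorb_iff2)
  have norm_g: "(\<Sum>i<N. (g Z i)\<^sup>2) = card Z * (real N - card Z) / N" if "Z \<subseteq> {..<N}" for Z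
  proof -
    have "(\<Sum>i<N. (g Z i)\<^sup>2)
        = (\<Sum>i<N. of_bool (i \<in> Z) * (1 - 2 * (real (card Z) / N)) + (real (card Z) / N)\<^sup>2)"
      by (intro sum.cong) (auto simp: g_def power2_eq_square algebra_simps)
    also have "\<dots> = real (card Z) * (1 - 2 * (real (card Z) / N)) + N * (real (card Z) / N)\<^sup>2"
      by (simp add: sum.distrib sum_distrib_right[symmetric] cardZ[OF that])
    also have "\<dots> = card Z * (real N - card Z) / N"
      using N0 by (simp add: field_simps power2_eq_square)
    finally show ?thesis .
  qed
  \<comment> \<open>Vanishing row sums remove the centring of \<open>Y\<close> in
    \<open>hval\<close>; by symmetry the column sums vanish too, and \<open>hsum\<close> removes
    that of \<open>X\<close>.\<close>
  have row0: "(\<Sum>j<N. deflated $$ (i, j)) = 0" if "i < N" for i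
  proof -
    have "(\<Sum>j<N. deflated $$ (i, j)) = (\<Sum>j<N. norm_adj_matrix N E $$ (i, j)) - (\<Sum>j<N. 1 / real N)"
      unfolding sum_subtractf[symmetric] using that by (intro sum.cong) (auto simp: deflated_def)
    then show ?thesis using that N0 by (simp add: sum_norm_adj_row)
  qed
  have hval: "h i = real (card {y \<in> Y. E i y}) / d - card Y / N" if i: "i < N" for i
  proof -
    have "h i = (\<Sum>j<N. deflated $$ (i, j) * of_bool (j \<in> Y)) - (\<Sum>j<N. deflated $$ (i, j)) * (card Y / N)"
      unfolding h_def mat_apply_def g_def sum_distrib_right sum_subtractf[symmetric]
      by (intro sum.cong) (auto simp: algebra_simps)
    also have "\<dots> = (\<Sum>j<N. deflated $$ (i, j) * of_bool (j \<in> Y))" by (simp add: row0[OF i])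
    also have "\<dots> = (\<Sum>j<N. of_bool (j \<in> {y \<in> Y. E i y}) / d - of_bool (j \<in> Y) / N)"
      using i by (intro sum.cong) (auto simp: deflated_index)
    also have "\<dots> = real (card {y \<in> Y. E i y}) / d - card Y / N"
      unfolding sum_subtractf sum_divide_distrib[symmetric]
      by (subst (1 2) cardZ) (use Y in auto)
    finally show ?thesis .
  qed
  have "(\<Sum>i<N. h i) = (\<Sum>j<N. \<Sum>i<N. deflated $$ (i, j) * g Y j)"
    unfolding h_def mat_apply_def by (rule sum.swap)
  also have "\<dots> = (\<Sum>j<N. (\<Sum>i<N. deflated $$ (j, i)) * g Y j)"
    unfolding sum_distrib_right using E_sym by (intro sum.cong) (auto simp: deflated_index)
  finally have hsum: "(\<Sum>i<N. h i) = 0" by (simp add: row0)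
  have "(\<Sum>i<N. g X i * h i) = (\<Sum>i<N. if i \<in> X then h i else 0) - (card X / N) * (\<Sum>i<N. h i)"
    unfolding g_def sum_distrib_left sum_subtractf[symmetric]
    by (intro sum.cong) (auto simp: algebra_simps)
  also have "\<dots> = (\<Sum>i\<in>X. h i)"
    unfolding hsum using X by (simp add: Int_absorb1 flip: sum.inter_restrict)
  also have "\<dots> = (\<Sum>i\<in>X. real (card {y \<in> Y. E i y}) / d - card Y / N)"
    using X by (intro sum.cong) (auto simp: hval)
  also have "\<dots> = real (\<Sum>i\<in>X. card {y \<in> Y. E i y}) / d - card X * (card Y / N)"
    by (simp add: sum_subtractf sum_divide_distrib)
  also have "(\<Sum>i\<in>X. card {y \<in> Y. E i y}) = card (edge_pairs X Y)"
  proof -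
    have "edge_pairs X Y = Sigma X (\<lambda>i. {y \<in> Y. E i y})" by (auto simp: edge_pairs_def)
    moreover have "finite X" "finite Y" using X Y finite_subset by auto
    ultimately show ?thesis by simp
  qed
  finally have inner: "(\<Sum>i<N. g X i * h i)
      = real (card (edge_pairs X Y)) / d - real (card X) * real (card Y) / N" by simp
  have "(\<Sum>i<N. g X i * h i)\<^sup>2 \<le> (\<Sum>i<N. (g X i)\<^sup>2) * (\<Sum>i<N. (h i)\<^sup>2)"
    by (rule sum_Cauchy_Schwarz)
  also have "\<dots> \<le> (\<Sum>i<N. (g X i)\<^sup>2) * (\<epsilon>\<^sup>2 * (\<Sum>i<N. (g Y i)\<^sup>2))"
    unfolding h_def by (intro mult_left_mono deflated_contraction sum_nonneg) auto
  finally show ?thesis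
    unfolding inner norm_g[OF X] norm_g[OF Y]
    by (simp only: mult.left_commute[of _ "\<epsilon>\<^sup>2"] mult.assoc)
qed

end

section \<open>Matchings and augmenting paths\<close>

text \<open>Lists are read in blocks of two. For an augmenting path \<open>u # I @ [v]\<close>, the
  blocks starting at \<open>u\<close> are the edges outside the matching, and the blocks of
  \<open>I\<close>, shifted by one, are the matching edges; \<open>rematch\<close> thus forms the
  symmetric difference.\<close>

fun rematch :: "(nat \<Rightarrow> nat) \<Rightarrow> nat list \<Rightarrow> nat \<Rightarrow> nat" where
  "rematch f (x # y # r) = (rematch f r)(x := y, y := x)"
| "rematch f _ = f"

fun paired :: "(nat \<Rightarrow> nat) \<Rightarrow> nat list \<Rightarrow> bool" where
  "paired f [] \<longleftrightarrow> True"
| "paired f [x] \<longleftrightarrow> False"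
| "paired f (x # y # r) \<longleftrightarrow> f x = y \<and> f y = x \<and> paired f r"

lemma paired_append: "even (length xs) \<Longrightarrow> paired f (xs @ ys) \<longleftrightarrow> paired f xs \<and> paired f ys"
  by (induction f xs rule: paired.induct) auto

lemma paired_even: "paired f xs \<Longrightarrow> even (length xs)"
  by (induction f xs rule: paired.induct) auto

lemma paired_rev: "paired f xs \<Longrightarrow> paired f (rev xs)"
  by (induction f xs rule: paired.induct) (auto simp: paired_append paired_even)

lemma paired_closed: "paired f xs \<Longrightarrow> v \<in> set xs \<Longrightarrow> f v \<in> set xs"
  by (induction f xs rule: paired.induct) auto

lemma paired_neq: "paired f xs \<Longrightarrow> distinct xs \<Longrightarrow> v \<in> set xs \<Longrightarrow> f v \<noteq> v"
  by (induction f xs rule: paired.induct) auto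

lemma paired_unique: "paired f xs \<Longrightarrow> paired g xs \<Longrightarrow> v \<in> set xs \<Longrightarrow> f v = g v"
  by (induction f xs rule: paired.induct) auto

lemma rematch_outside: "v \<notin> set P \<Longrightarrow> rematch f P v = f v"
  by (induction f P rule: rematch.induct) auto

context regular_expander
begin

section \<open>Consequences of the mixing lemma\<close>

lemma eps_lt_one: "\<epsilon> < 1"
  using eps_le by simp

lemma card_le_N: "X \<subseteq> {..<N} \<Longrightarrow> real (card X) \<le> real N"
  using card_mono[of "{..<N}" X] by (simp only: of_nat_le_iff finite_lessThan card_lessThan)

text \<open>With no edges, both sides of the mixing inequality share the factor
  \<open>a * b / m\<^sup>2\<close>, which cancels when neither set is empty.\<close>

lemma no_edges_bound:
  assumes X: "X \<subseteq> {..<N}" and Y: "Y \<subseteq> {..<N}" and "edge_pairs X Y = {}"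
  shows "real (card X) * real (card Y) \<le> \<epsilon>\<^sup>2 * (real N - card X) * (real N - card Y)"
proof (cases "card X = 0 \<or> card Y = 0")
  case True
  then show ?thesis using card_le_N[OF X] card_le_N[OF Y] by auto
next
  case False
  define a b m where ab: "a = real (card X)" "b = real (card Y)" "m = real N"
  have pos: "a > 0" "b > 0" "m > 0" using False n_pos by (auto simp: ab)
  have "(a * b / m)\<^sup>2 \<le> \<epsilon>\<^sup>2 * (a * (m - a) / m) * (b * (m - b) / m)"
    using expander_mixing[OF X Y] assms(3) unfolding ab[symmetric] by simp
  moreover have "(a * b / m)\<^sup>2 = (a * b / m\<^sup>2) * (a * b)" by (simp add: power2_eq_square)
  moreover have "\<epsilon>\<^sup>2 * (a * (m - a) / m) * (b * (m - b) / m) = (a * b / m\<^sup>2) * (\<epsilon>\<^sup>2 * (m - a) * (m - b))"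
    by (simp add: power2_eq_square)
  ultimately have "(a * b / m\<^sup>2) * (a * b) \<le> (a * b / m\<^sup>2) * (\<epsilon>\<^sup>2 * (m - a) * (m - b))"
    by simp
  moreover have "a * b / m\<^sup>2 > 0" using pos by simp
  ultimately have "a * b \<le> \<epsilon>\<^sup>2 * (m - a) * (m - b)" by (simp only: mult_le_cancel_left_pos)
  then show ?thesis by (simp only: ab)
qed

text \<open>A single vertex has no edge to itself. The resulting
  \<open>1 / 2 \<le> \<epsilon> * n\<close> later pays for a constant and for one factor
  \<open>d\<close>.\<close>

lemma eps_N_ge_1: "1 \<le> \<epsilon> * real N"
proof -
  have "edge_pairs {0} {0} = {}" using E_irrefl by (auto simp: edge_pairs_def)
  then have "1 \<le> \<epsilon>\<^sup>2 * (real N - 1) * (real N - 1)"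
    using no_edges_bound[of "{0}" "{0}"] n_pos by simp
  also have "\<dots> = (\<epsilon> * (real N - 1))\<^sup>2" by (simp add: power2_eq_square)
  finally have "1 \<le> (\<epsilon> * (real N - 1))\<^sup>2" .
  then have "1 \<le> \<epsilon> * (real N - 1)"
    using eps_pos n_pos by (intro power2_le_imp_le[of 1]) auto
  also have "\<dots> \<le> \<epsilon> * real N" using eps_pos by simp
  finally show ?thesis .
qed

text \<open>With both sets equal to \<open>S\<close> the right side of the mixing inequality is a
  square, so a root can be taken; only the lower deviation is kept.\<close>

lemma internal_edges_bound:
  fixes s :: real
  assumes S: "S \<subseteq> {..<N}"
  defines "s \<equiv> real (card S)"
  shows "d * s * (s / N - \<epsilon> * (1 - s / N)) \<le> real (card (edge_pairs S S))"
proof -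
  define e m where "e = real (card (edge_pairs S S))" and "m = real N"
  define K where "K = \<epsilon> * (s * (m - s) / m)"
  have m0: "m > 0" using n_pos by (simp add: m_def)
  have sm: "0 \<le> s" "s \<le> m" using card_le_N[OF S] by (auto simp: s_def m_def)
  have "(e / d - s * s / m)\<^sup>2 \<le> \<epsilon>\<^sup>2 * (s * (m - s) / m) * (s * (m - s) / m)"
    using expander_mixing[OF S S] unfolding s_def e_def m_def .
  also have "\<dots> = K\<^sup>2" by (simp add: power2_eq_square K_def)
  finally have "\<bar>e / d - s * s / m\<bar> \<le> \<bar>K\<bar>" by (simp only: abs_le_square_iff)
  moreover have "0 \<le> K" using sm eps_pos m0 by (simp add: K_def)
  ultimately have "s * s / m - K \<le> e / d" by linarith
  moreover have "s * s / m - K = s * (s / m - \<epsilon> * (1 - s / m))"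
    using m0 by (simp add: K_def field_simps)
  ultimately have "s * (s / m - \<epsilon> * (1 - s / m)) \<le> e / d" by simp
  then have "s * (s / m - \<epsilon> * (1 - s / m)) * d \<le> e"
    using d_pos by (simp add: pos_le_divide_eq)
  then show ?thesis by (simp only: e_def m_def mult_ac)
qed

section \<open>Matchings as involutions\<close>

definition unmatched :: "(nat \<Rightarrow> nat) \<Rightarrow> nat set" where
  "unmatched f = {v. v < N \<and> f v = v}"

text \<open>A matching is encoded by the involution exchanging the endpoints of its edges;
  \<open>matchings j\<close> collects those leaving exactly \<open>2 * j\<close> vertices uncovered.\<close>

definition matchings :: "nat \<Rightarrow> (nat \<Rightarrow> nat) set" where
  "matchings j = {f. (\<forall>v. f (f v) = v) \<and> (\<forall>v. f v \<noteq> v \<longrightarrow> E v (f v)) \<and> card (unmatched f) = 2 * j}"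

lemma matchingsD:
  assumes "f \<in> matchings j"
  shows "f (f v) = v" and "f v \<noteq> v \<Longrightarrow> E v (f v)" and "card (unmatched f) = 2 * j"
    and "v < N \<Longrightarrow> f v < N" and "\<not> v < N \<Longrightarrow> f v = v" and "inj f"
proof -
  show "f (f v) = v" and *: "f v \<noteq> v \<Longrightarrow> E v (f v)" and "card (unmatched f) = 2 * j"
    using assms by (auto simp: matchings_def)
  show "v < N \<Longrightarrow> f v < N" using * E_less(2) by metis
  show "\<not> v < N \<Longrightarrow> f v = v" using * E_less(1) by metis
  show "inj f" using assms by (intro injI) (metis (mono_tags, lifting) matchings_def mem_Collect_eq)
qed

lemma finite_unmatched: "finite (unmatched f)"
  by (simp add: unmatched_def)

lemma finite_matchings: "finite (matchings j)"
proof (rule inj_on_finite)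
  show "inj_on (\<lambda>f. map f [0..<N]) (matchings j)"
  proof (rule inj_onI, rule ext)
    fix f g v assume fg: "f \<in> matchings j" "g \<in> matchings j" "map f [0..<N] = map g [0..<N]"
    show "f v = g v"
      using fg matchingsD(5)[OF fg(1), of v] matchingsD(5)[OF fg(2), of v] by (cases "v < N") auto
  qed
  show "(\<lambda>f. map f [0..<N]) ` matchings j \<subseteq> {xs. set xs \<subseteq> {..<N} \<and> length xs = N}"
    using matchingsD(4) by auto
  show "finite {xs. set xs \<subseteq> {..<N} \<and> length xs = N}"
    by (rule finite_lists_length_eq) simp
qed

lemma id_matching: "id \<in> matchings n"
  by (simp add: matchings_def unmatched_def)

text \<open>Passing from an involution to its set of edges is injective; a lower bound requires only
  this direction.\<close>

lemma card_matchings_0_le: "card (matchings 0) \<le> num_perfect_matchings N E"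
proof -
  let ?M = "\<lambda>f. {{v, f v} | v. v < N}"
  have nofix: "f v \<noteq> v" if "f \<in> matchings 0" "v < N" for f v
    using matchingsD(3)[OF that(1)] that(2) finite_unmatched[of f] by (auto simp: unmatched_def)
  have "?M ` matchings 0 \<subseteq> {M. perfect_matching N E M}"
  proof safe
    fix f assume f: "f \<in> matchings 0"
    show "perfect_matching N E (?M f)"
      unfolding perfect_matching_def
    proof (intro conjI allI impI)
      show "?M f \<subseteq> edges N E"
      proof
        fix e assume "e \<in> ?M f"
        then obtain v where v: "v < N" "e = {v, f v}" by auto
        then have "E v (f v)" using matchingsD(2)[OF f] nofix[OF f] by blast
        then show "e \<in> edges N E" using v matchingsD(4)[OF f] by (auto simp: edges_def)
      qed
      fix v assume v: "v < N"
      show "\<exists>!e. e \<in> ?M f \<and> v \<in> e"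
      proof (rule ex1I[of _ "{v, f v}"])
        show "{v, f v} \<in> ?M f \<and> v \<in> {v, f v}" using v by auto
        fix e assume "e \<in> ?M f \<and> v \<in> e"
        then obtain w where "e = {w, f w}" "v = w \<or> v = f w" by auto
        then show "e = {v, f v}" using matchingsD(1)[OF f, of w] by auto
      qed
    qed
  qed
  moreover have "inj_on ?M (matchings 0)"
  proof (rule inj_onI, rule ext)
    fix f g v assume f: "f \<in> matchings 0" and g: "g \<in> matchings 0" and eq: "?M f = ?M g"
    show "f v = g v"
    proof (cases "v < N")
      case True
      then have "{v, f v} \<in> ?M g" using eq by blast
      then obtain w where w: "{v, f v} = {w, g w}" by auto
      then show ?thesis using matchingsD(1)[OF g, of w] by (auto simp: doubleton_eq_iff)
    next
      case False
      then show ?thesis using matchingsD(5)[OF f] matchingsD(5)[OF g] by simp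
    qed
  qed
  moreover have "finite {M. perfect_matching N E M}"
  proof (rule finite_subset)
    show "{M. perfect_matching N E M} \<subseteq> Pow (Pow {..<N})"
      by (auto simp: perfect_matching_def edges_def)
  qed simp
  ultimately show ?thesis
    unfolding num_perfect_matchings_def by (intro card_inj_on_le)
qed

section \<open>Counting augmentations from both sides\<close>

fun linked :: "nat list \<Rightarrow> bool" where
  "linked [] \<longleftrightarrow> True"
| "linked [x] \<longleftrightarrow> False"
| "linked (x # y # r) \<longleftrightarrow> E x y \<and> linked r"

lemma linked_append: "even (length xs) \<Longrightarrow> linked (xs @ ys) \<longleftrightarrow> linked xs \<and> linked ys"
  by (induction xs rule: linked.induct) auto

lemma linked_even: "linked xs \<Longrightarrow> even (length xs)"
  by (induction xs rule: linked.induct) auto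

lemma linked_rev: "linked xs \<Longrightarrow> linked (rev xs)"
  by (induction xs rule: linked.induct) (auto simp: linked_append linked_even E_sym)

lemma linked_subset: "linked xs \<Longrightarrow> set xs \<subseteq> {..<N}"
  by (induction xs rule: linked.induct) (auto dest: E_less)

lemma paired_linked:
  "f \<in> matchings j \<Longrightarrow> paired f xs \<Longrightarrow> distinct xs \<Longrightarrow> linked xs"
  by (induction f xs rule: paired.induct) (auto intro: matchingsD(2)[OF _ not_sym])

lemma rematch_inside:
  "linked P \<Longrightarrow> distinct P \<Longrightarrow> v \<in> set P \<Longrightarrow>
    rematch f P v \<in> set P \<and> rematch f P (rematch f P v) = v \<and> E v (rematch f P v)"
proof (induction P arbitrary: v rule: linked.induct)
  case (3 x y r)
  show ?case
  proof (cases "v \<in> set r")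
    case True
    with 3 show ?thesis by auto
  next
    case False
    then have "v = x \<or> v = y" using 3 by simp
    moreover have "E x y" "E y x" "x \<noteq> y" using 3 E_sym by auto
    ultimately show ?thesis by auto
  qed
qed auto

text \<open>After the exchange the edges that were outside the matching belong to it, so
  \<open>P\<close> becomes an alternating walk of the new matching.\<close>

lemma paired_rematch: "linked P \<Longrightarrow> distinct P \<Longrightarrow> paired (rematch f P) P"
proof -
  have cong: "paired g xs \<longleftrightarrow> paired h xs" if "\<forall>v\<in>set xs. g v = h v" for g h xs
    using that by (induction g xs rule: paired.induct) auto
  show "linked P \<Longrightarrow> distinct P \<Longrightarrow> paired (rematch f P) P"
  proof (induction P rule: linked.induct)
    case (3 x y r)
    then have "paired (rematch f (x # y # r)) r"
      using cong[of r "rematch f (x # y # r)" "rematch f r"] by fastforce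
    with 3 show ?case by (simp add: fun_upd_def)
  qed auto
qed

text \<open>\<open>L\<close> counts the matching edges on the path, so \<open>P\<close> has
  \<open>2 * L + 2\<close> vertices. A path and its reversal are different elements.\<close>

definition augmenting :: "(nat \<Rightarrow> nat) \<Rightarrow> nat \<Rightarrow> nat list set" where
  "augmenting f L = {P. \<exists>u I v. P = u # I @ [v] \<and> length I = 2 * L \<and> paired f I \<and> linked P
     \<and> distinct P \<and> f u = u \<and> f v = v}"

lemma finite_augmenting: "finite (augmenting f L)"
proof (rule finite_subset)
  show "augmenting f L \<subseteq> {xs. set xs \<subseteq> {..<N} \<and> length xs = 2 * L + 2}"
    using linked_subset by (auto simp: augmenting_def)
qed (simp add: finite_lists_length_eq)

text \<open>Interior vertices are covered before and after, since \<open>paired\<close> on a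
  distinct list excludes fixed points; exactly the two ends leave
  \<open>unmatched f\<close>.\<close>

lemma rematch_augmenting:
  assumes f: "f \<in> matchings (Suc j)" and P: "P \<in> augmenting f L"
  shows "rematch f P \<in> matchings j"
proof -
  obtain u I v where P': "P = u # I @ [v]" "paired f I" "linked P" "distinct P" "f u = u" "f v = v"
    using P by (auto simp: augmenting_def)
  let ?g = "rematch f P"
  note inside = rematch_inside[OF P'(3,4), of _ f]
  have closed: "f w \<in> set P" if "w \<in> set P" for w
    using that P' paired_closed[OF P'(2)] by auto
  have invol: "?g (?g w) = w" for w
  proof (cases "w \<in> set P")
    case True
    then show ?thesis using inside by blast
  next
    case False
    then have "f w \<notin> set P" using closed[of "f w"] matchingsD(1)[OF f, of w] by auto
    then show ?thesis using False matchingsD(1)[OF f] by (simp add: rematch_outside)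
  qed
  have edge: "E w (?g w)" if "?g w \<noteq> w" for w
    using that inside matchingsD(2)[OF f] by (cases "w \<in> set P") (auto simp: rematch_outside)
  have uv: "{u, v} \<subseteq> unmatched f" "u \<noteq> v"
    using P' linked_subset[OF P'(3)] by (auto simp: unmatched_def)
  have "w \<in> unmatched ?g \<longleftrightarrow> w \<in> unmatched f - {u, v}" for w
  proof (cases "w \<in> set P")
    case True
    then have "?g w \<noteq> w" using inside E_irrefl by metis
    moreover have "f w \<noteq> w \<or> w \<in> {u, v}"
      using True P' paired_neq[OF P'(2)] by auto
    ultimately show ?thesis by (auto simp: unmatched_def)
  next
    case False
    then show ?thesis using P'(1) by (auto simp: unmatched_def rematch_outside)
  qed
  then have "unmatched ?g = unmatched f - {u, v}" by blast
  then have "card (unmatched ?g) = 2 * j"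
    using uv matchingsD(3)[OF f] by (simp add: card_Diff_subset)
  with invol edge show ?thesis by (simp add: matchings_def)
qed

text \<open>The path determines the old matching on its own vertices, and off the path nothing has
  changed.\<close>

lemma rematch_inj:
  assumes f: "P \<in> augmenting f L" and g: "P \<in> augmenting g L" and eq: "rematch f P = rematch g P"
  shows "f = g"
proof
  fix w
  obtain u I v where P: "P = u # I @ [v]" "paired f I" "f u = u" "f v = v"
    using f by (auto simp: augmenting_def)
  with g have Q: "paired g I" "g u = u" "g v = v" by (auto simp: augmenting_def)
  show "f w = g w"
  proof (cases "w \<in> set P")
    case True
    then show ?thesis using P Q paired_unique[OF P(2) Q(1)] by auto
  next
    case False
    then show ?thesis using eq rematch_outside[of w P f] rematch_outside[of w P g] by simp
  qed
qed

text \<open>The steps along \<open>g\<close> are forced, so only the \<open>L\<close> edges between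
  them are free, with at most \<open>d\<close> choices each. Repeated vertices are allowed, which is
  harmless for an upper bound.\<close>

fun alternating_walks :: "(nat \<Rightarrow> nat) \<Rightarrow> nat \<Rightarrow> nat \<Rightarrow> nat list set" where
  "alternating_walks g 0 x = {[x, g x]}"
| "alternating_walks g (Suc L) x =
     (\<Union>y\<in>{y. E (g x) y}. (\<lambda>r. x # g x # r) ` alternating_walks g L y)"

lemma finite_alternating_walks: "finite (alternating_walks g L x)"
  by (induction g L x rule: alternating_walks.induct) (auto simp: finite_neighbours)

lemma card_alternating_walks: "card (alternating_walks g L x) \<le> d ^ L"
proof (induction g L x rule: alternating_walks.induct)
  case (2 g L x)
  have deg: "card {y. E (g x) y} \<le> d"
  proof (cases "g x < N")
    case False
    then have "{y. E (g x) y} = {}" using E_less(1) by blast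
    then show ?thesis by simp
  qed (simp add: card_neighbours)
  have "card (alternating_walks g (Suc L) x)
      \<le> (\<Sum>y\<in>{y. E (g x) y}. card ((\<lambda>r. x # g x # r) ` alternating_walks g L y))"
    by (simp add: card_UN_le finite_neighbours)
  also have "\<dots> \<le> (\<Sum>y\<in>{y. E (g x) y}. d ^ L)"
    using 2 by (intro sum_mono order_trans[OF card_image_le]) (auto simp: finite_alternating_walks)
  also have "\<dots> \<le> d * d ^ L" using deg by simp
  finally show ?case by simp
qed auto

lemma in_alternating_walks:
  "paired g (u # I @ [v]) \<Longrightarrow> linked I \<Longrightarrow> length I = 2 * L \<Longrightarrow> u # I @ [v] \<in> alternating_walks g L u"
proof (induction L arbitrary: u I)
  case (Suc L)
  then obtain a b J where I: "I = a # b # J" "length J = 2 * L"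
    by (auto simp: length_Suc_conv)
  with Suc have "b # J @ [v] \<in> alternating_walks g L b" by auto
  then show ?case using Suc.prems I by auto
qed auto

text \<open>Double counting: \<open>(f, P)\<close> can be recovered from the new matching together
  with \<open>P\<close>, and \<open>P\<close> is an alternating walk of the new matching starting at
  one of its \<open>N - 2 * j\<close> covered vertices.\<close>

lemma augmenting_count:
  "(\<Sum>f\<in>matchings (Suc j). card (augmenting f L)) \<le> card (matchings j) * ((N - 2 * j) * d ^ L)"
proof -
  let ?A = "Sigma (matchings (Suc j)) (\<lambda>f. augmenting f L)"
  let ?W = "\<lambda>g. \<Union>u\<in>{..<N} - unmatched g. alternating_walks g L u"
  let ?h = "\<lambda>(f, P). (rematch f P, P)"
  have fin: "finite (?W g)" for g by (simp add: finite_alternating_walks)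
  have W: "card (?W g) \<le> (N - 2 * j) * d ^ L" if g: "g \<in> matchings j" for g
  proof -
    have "unmatched g \<subseteq> {..<N}" by (auto simp: unmatched_def)
    then have "card ({..<N} - unmatched g) = N - 2 * j"
      using matchingsD(3)[OF g] by (simp add: card_Diff_subset finite_unmatched)
    moreover have "card (?W g) \<le> (\<Sum>u\<in>{..<N} - unmatched g. card (alternating_walks g L u))"
      by (intro card_UN_le) simp
    moreover have "\<dots> \<le> (\<Sum>u\<in>{..<N} - unmatched g. d ^ L)"
      by (intro sum_mono card_alternating_walks)
    ultimately show ?thesis by simp
  qed
  have "?h ` ?A \<subseteq> Sigma (matchings j) ?W"
  proof (clarsimp, intro conjI)
    fix f P assume f: "f \<in> matchings (Suc j)" and P: "P \<in> augmenting f L"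
    show "rematch f P \<in> matchings j" by (rule rematch_augmenting[OF f P])
    obtain u I v where P': "P = u # I @ [v]" "length I = 2 * L" "paired f I" "linked P" "distinct P"
      using P by (auto simp: augmenting_def)
    have "linked I" by (rule paired_linked[OF f P'(3)]) (use P' in auto)
    then have "P \<in> alternating_walks (rematch f P) L u"
      using in_alternating_walks[of "rematch f P" u I v L] paired_rematch[OF P'(4,5), of f] P'(1,2) by simp
    moreover have "rematch f P u \<noteq> u" "u < N"
      using rematch_inside[OF P'(4,5), of u f] P'(1) E_irrefl E_less(1) by (metis list.set_intros(1))+
    ultimately show "\<exists>u\<in>{..<N} - unmatched (rematch f P). P \<in> alternating_walks (rematch f P) L u"
      by (auto simp: unmatched_def)
  qed
  moreover have "inj_on ?h ?A"
    by (rule inj_onI) (use rematch_inj in \<open>auto\<close>)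
  moreover have "finite (Sigma (matchings j) ?W)"
    by (intro finite_SigmaI finite_matchings fin)
  ultimately have "card ?A \<le> card (Sigma (matchings j) ?W)" by (intro card_inj_on_le)
  also have "\<dots> = (\<Sum>g\<in>matchings j. card (?W g))"
    by (intro card_SigmaI) (auto simp: finite_matchings fin)
  also have "\<dots> \<le> (\<Sum>g\<in>matchings j. (N - 2 * j) * d ^ L)" by (intro sum_mono W)
  finally show ?thesis by (simp add: card_SigmaI finite_matchings finite_augmenting)
qed

text \<open>Both phases rest on this comparison: the greedy one takes \<open>L = 0\<close>, the
  descent below \<open>q\<close> takes \<open>L = 2 * t + 1\<close>.\<close>

lemma augmenting_step:
  assumes "\<And>f. f \<in> matchings (Suc j) \<Longrightarrow> c \<le> real (card (augmenting f L))" and j: "2 * j \<le> N"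
  shows "real (card (matchings (Suc j))) * c \<le> real (card (matchings j)) * ((real N - 2 * real j) * real d ^ L)"
proof -
  have "real (card (matchings (Suc j))) * c \<le> (\<Sum>f\<in>matchings (Suc j). real (card (augmenting f L)))"
    using sum_mono[of "matchings (Suc j)" "\<lambda>_. c"] assms(1) by simp
  also have "\<dots> \<le> real (card (matchings j) * ((N - 2 * j) * d ^ L))"
    using augmenting_count[of L j] by (simp only: of_nat_sum[symmetric] of_nat_le_iff)
  finally show ?thesis using j by (simp add: of_nat_diff)
qed

lemma card_augmenting_0_ge:
  "card (edge_pairs (unmatched f) (unmatched f)) \<le> card (augmenting f 0)"
proof (rule card_inj_on_le[of "\<lambda>(u, v). [u, v]"])
  show "inj_on (\<lambda>(u, v). [u, v]) (edge_pairs (unmatched f) (unmatched f))" by (auto intro!: inj_onI)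
  show "(\<lambda>(u, v). [u, v]) ` edge_pairs (unmatched f) (unmatched f) \<subseteq> augmenting f 0"
    using E_irrefl by (auto simp: edge_pairs_def augmenting_def unmatched_def)
qed (rule finite_augmenting)

end

section \<open>Short augmenting paths in expanders\<close>

context regular_expander
begin

section \<open>Growing disjoint families of alternating paths\<close>

text \<open>The equation \<open>u # I = Q @ [x]\<close> splits one path in two ways:
  \<open>I\<close> groups it into its \<open>t\<close> matching edges, \<open>Q\<close> into the
  edges leading to them.\<close>

definition reaches :: "(nat \<Rightarrow> nat) \<Rightarrow> nat set \<Rightarrow> nat \<Rightarrow> nat \<Rightarrow> bool" where
  "reaches f V t x \<longleftrightarrow> (\<exists>u I Q. u # I = Q @ [x] \<and> length I = 2 * t \<and> paired f I \<and> linked Q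
     \<and> distinct (u # I) \<and> set (u # I) \<subseteq> V \<and> f u = u)"

lemma reaches_root: "f x = x \<Longrightarrow> x \<in> V \<Longrightarrow> reaches f V 0 x"
  unfolding reaches_def by (intro exI[of _ x] exI[of _ "[]"]) auto

lemma reaches_step:
  assumes "reaches f V t x" and a: "E x a" "a \<notin> V" "f a \<notin> V" "f a \<noteq> a" "f (f a) = a"
    and V': "V \<subseteq> V'" "a \<in> V'" "f a \<in> V'"
  shows "reaches f V' (Suc t) (f a)"
proof -
  obtain u I Q where r: "u # I = Q @ [x]" "length I = 2 * t" "paired f I" "linked Q"
      "distinct (u # I)" "set (u # I) \<subseteq> V" "f u = u"
    using assms(1) unfolding reaches_def by blast
  show ?thesis unfolding reaches_def
  proof (intro exI conjI)
    show "u # (I @ [a, f a]) = (Q @ [x, a]) @ [f a]" using r(1) by simp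
    show "paired f (I @ [a, f a])" using r(2,3) a(5) by (simp add: paired_append)
    show "linked (Q @ [x, a])" using r(4) a(1) by (simp add: linked_append linked_even)
    show "distinct (u # (I @ [a, f a]))" using r(5,6) a by auto
    show "set (u # (I @ [a, f a])) \<subseteq> V'" using r(6) V' by auto
  qed (use r in auto)
qed

text \<open>The path runs from \<open>u1\<close> to \<open>x1\<close>, crosses \<open>a\<close> and
  \<open>f a\<close>, and follows the second path backwards, with t + 1 + t matching edges.
  Recording the position of \<open>a\<close> ensures that different \<open>a\<close> give different
  paths.\<close>

lemma reaches_join:
  assumes r1: "reaches f V1 t x1" and r2: "reaches f V2 t x2" and V: "V1 \<inter> V2 = {}"
    and a: "E x1 a" "E x2 (f a)" "a \<notin> V1 \<union> V2" "f a \<notin> V1 \<union> V2" "f a \<noteq> a" "f (f a) = a"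
  shows "\<exists>P\<in>augmenting f (2 * t + 1). P ! (2 * t + 1) = a"
proof -
  obtain u1 I1 Q1 where q1: "u1 # I1 = Q1 @ [x1]" "length I1 = 2 * t" "paired f I1" "linked Q1"
      "distinct (u1 # I1)" "set (u1 # I1) \<subseteq> V1" "f u1 = u1"
    using r1 unfolding reaches_def by blast
  obtain u2 I2 Q2 where q2: "u2 # I2 = Q2 @ [x2]" "length I2 = 2 * t" "paired f I2" "linked Q2"
      "distinct (u2 # I2)" "set (u2 # I2) \<subseteq> V2" "f u2 = u2"
    using r2 unfolding reaches_def by blast
  define I where "I = I1 @ [a, f a] @ rev I2"
  define P where "P = u1 # I @ [u2]"
  \<comment> \<open>The first decomposition serves distinctness; the second is aligned with the
    blocks of \<open>linked\<close>.\<close>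
  have P1: "P = (u1 # I1) @ [a, f a] @ rev (u2 # I2)" by (simp add: P_def I_def)
  have P2: "P = Q1 @ [x1, a] @ [f a, x2] @ rev Q2"
    unfolding P1 q1(1) q2(1) by simp
  have "linked P"
    unfolding P2 using q1(4) q2(4) a(1,2) E_sym
    by (simp add: linked_append linked_even linked_rev)
  moreover have "distinct P"
    unfolding P1 using q1(5,6) q2(5,6) V a by auto
  moreover have "paired f I"
    unfolding I_def using q1(2,3) q2(3) a(6) by (simp add: paired_append paired_rev)
  moreover have "length I = 2 * (2 * t + 1)" using q1(2) q2(2) by (simp add: I_def)
  ultimately have "P \<in> augmenting f (2 * t + 1)"
    unfolding augmenting_def using P_def q1(7) q2(7) by blast
  moreover have "P ! (2 * t + 1) = a"
    using q1(2) by (simp add: P_def I_def nth_append)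
  ultimately show ?thesis by blast
qed

text \<open>Alternating paths are grown simultaneously from two halves of the uncovered vertices, inside
  disjoint sets \<open>V1\<close>, \<open>V2\<close>; joining a path in \<open>V1\<close> to one in \<open>V2\<close> therefore never
  creates a blossom.\<close>

definition grown :: "(nat \<Rightarrow> nat) \<Rightarrow> nat \<Rightarrow> nat \<Rightarrow> nat set \<Rightarrow> nat set \<Rightarrow> nat set \<Rightarrow> nat set \<Rightarrow> bool" where
  "grown f t s X1 X2 V1 V2 \<longleftrightarrow>
     X1 \<subseteq> V1 \<and> X2 \<subseteq> V2 \<and> V1 \<inter> V2 = {} \<and> V1 \<union> V2 \<subseteq> {..<N} \<and> unmatched f \<subseteq> V1 \<union> V2
     \<and> f ` V1 \<subseteq> V1 \<and> f ` V2 \<subseteq> V2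
     \<and> (\<forall>x\<in>X1. reaches f V1 t x) \<and> (\<forall>x\<in>X2. reaches f V2 t x)
     \<and> card X1 = s \<and> card X2 = s \<and> card V1 \<le> 4 * s \<and> card V2 \<le> 4 * s"

lemma grownD:
  assumes "grown f t s X1 X2 V1 V2"
  shows "X1 \<subseteq> V1" "X2 \<subseteq> V2" "V1 \<inter> V2 = {}" "V1 \<union> V2 \<subseteq> {..<N}" "unmatched f \<subseteq> V1 \<union> V2"
    "f ` V1 \<subseteq> V1" "f ` V2 \<subseteq> V2"
    "\<And>x. x \<in> X1 \<Longrightarrow> reaches f V1 t x" "\<And>x. x \<in> X2 \<Longrightarrow> reaches f V2 t x"
    "card X1 = s" "card X2 = s" "card V1 \<le> 4 * s" "card V2 \<le> 4 * s"
  using assms unfolding grown_def by blast+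

lemma grown_outside:
  assumes f: "f \<in> matchings j" and g: "grown f t s X1 X2 V1 V2"
    and a: "a \<in> {..<N} - (V1 \<union> V2)"
  shows "f a \<in> {..<N} - (V1 \<union> V2)" "f a \<noteq> a"
proof -
  show "f a \<noteq> a" using a grownD(5)[OF g] by (auto simp: unmatched_def)
  have "f a \<notin> V1 \<union> V2"
    using a grownD(6,7)[OF g] matchingsD(1)[OF f, of a] by (metis DiffD2 UnCI UnE image_subset_iff)
  then show "f a \<in> {..<N} - (V1 \<union> V2)" using a matchingsD(4)[OF f] by auto
qed

lemma card_outside:
  assumes g: "grown f t s X1 X2 V1 V2"
  shows "real N - 8 * real s \<le> real (card ({..<N} - (V1 \<union> V2)))"
proof -
  have "card (V1 \<union> V2) \<le> 8 * s"
    using card_Un_le[of V1 V2] grownD(12,13)[OF g] by simp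
  moreover have "card ({..<N} - (V1 \<union> V2)) = N - card (V1 \<union> V2)"
    using grownD(4)[OF g] by (subst card_Diff_subset) (auto intro: finite_subset)
  ultimately show ?thesis by linarith
qed

lemma non_neighbours_bound:
  assumes X: "X \<subseteq> {..<N}" and W: "W \<subseteq> {..<N}"
  shows "real (card X) * card {a \<in> W. \<not> (\<exists>x\<in>X. E x a)}
    \<le> \<epsilon>\<^sup>2 * (real N * (real N - card {a \<in> W. \<not> (\<exists>x\<in>X. E x a)}))"
proof -
  let ?Y = "{a \<in> W. \<not> (\<exists>x\<in>X. E x a)}"
  have Y: "?Y \<subseteq> {..<N}" using W by auto
  have "edge_pairs X ?Y = {}" by (auto simp: edge_pairs_def)
  then have "real (card X) * card ?Y \<le> \<epsilon>\<^sup>2 * (real N - card X) * (real N - card ?Y)"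
    by (rule no_edges_bound[OF X Y])
  also have "\<dots> = \<epsilon>\<^sup>2 * ((real N - card X) * (real N - card ?Y))" by simp
  also have "\<dots> \<le> \<epsilon>\<^sup>2 * (real N * (real N - card ?Y))"
    using card_le_N[OF Y] by (intro mult_left_mono mult_right_mono) auto
  finally show ?thesis .
qed

text \<open>With fewer than \<open>6 * s\<close> neighbours, at least \<open>N - 14 * s\<close>
  vertices would be non-neighbours, where 14 = 8 + 6. The factor \<open>N - card Y\<close> then caps
  their number at \<open>14 * \<epsilon>\<^sup>2 * N\<close>, which is too small since
  \<open>s \<le> \<epsilon> * N / 4\<close>.\<close>

lemma many_new_neighbours:
  assumes X: "X \<subseteq> {..<N}" "card X = s" "s \<ge> 1" and W: "W \<subseteq> {..<N}" "real N - 8 * real s \<le> card W"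
    and s: "4 * real s \<le> \<epsilon> * real N"
  shows "6 * s \<le> card {a \<in> W. \<exists>x\<in>X. E x a}"
proof (rule ccontr)
  let ?A = "{a \<in> W. \<exists>x\<in>X. E x a}" and ?Y = "{a \<in> W. \<not> (\<exists>x\<in>X. E x a)}"
  assume "\<not> ?thesis"
  then have A: "real (card ?A) \<le> 6 * real s" by simp
  define m y where "m = real N" and "y = real (card ?Y)"
  have m: "m > 0" using n_pos by (simp add: m_def)
  have "finite W" using W(1) finite_subset by auto
  then have "card W = card ?A + card ?Y"
    by (subst card_Un_disjoint[symmetric]) (auto intro: arg_cong[of _ _ card])
  then have y: "m - 14 * real s \<le> y" using W(2) A by (simp add: m_def y_def)
  have "real s * y \<le> \<epsilon>\<^sup>2 * (m * (m - y))"
    using non_neighbours_bound[OF X(1) W(1)] unfolding X(2) m_def y_def .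
  also have "\<dots> \<le> \<epsilon>\<^sup>2 * (m * (14 * real s))"
    using y m by (intro mult_left_mono) auto
  also have "\<dots> = real s * (14 * \<epsilon>\<^sup>2 * m)" by simp
  finally have "real s * y \<le> real s * (14 * \<epsilon>\<^sup>2 * m)" .
  then have "y \<le> 14 * (\<epsilon>\<^sup>2 * m)" using X(3) by simp
  moreover have "\<epsilon>\<^sup>2 * m \<le> (1 / 11)\<^sup>2 * m"
    using m eps_le eps_pos by (intro mult_right_mono power_mono) auto
  then have "\<epsilon>\<^sup>2 * m \<le> m / 121" by (simp add: power2_eq_square)
  moreover have "\<epsilon> * m \<le> 1 / 11 * m" using m eps_le by (intro mult_right_mono) auto
  ultimately show False using y s m unfolding m_def[symmetric] by linarith
qed

lemma grown_start:
  assumes f: "f \<in> matchings j"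
  shows "\<exists>X1 X2 V1 V2. grown f 0 j X1 X2 V1 V2"
proof -
  have c: "card (unmatched f) = 2 * j" by (rule matchingsD(3)[OF f])
  then obtain U1 where U1: "U1 \<subseteq> unmatched f" "card U1 = j"
    using obtain_subset_with_card_n[of j "unmatched f"] by auto
  have "finite U1" using U1 finite_unmatched finite_subset by blast
  then have "card (unmatched f - U1) = j" using U1 c by (simp add: card_Diff_subset)
  then have "grown f 0 j U1 (unmatched f - U1) U1 (unmatched f - U1)"
    using U1 by (auto simp: grown_def unmatched_def intro!: reaches_root)
  then show ?thesis by blast
qed

text \<open>Each side takes \<open>2 * s\<close> fresh neighbours and moves to their partners. The
  second side must avoid the up to \<open>4 * s\<close> vertices just used by the first, which is
  why \<open>6 * s\<close> candidates are demanded.\<close>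

lemma grown_step:
  assumes f: "f \<in> matchings j" and g: "grown f t s X1 X2 V1 V2" and s: "s \<ge> 1"
    and s2: "4 * real s \<le> \<epsilon> * real N"
  shows "\<exists>X1 X2 V1 V2. grown f (Suc t) (2 * s) X1 X2 V1 V2"
proof -
  define W where "W = {..<N} - (V1 \<union> V2)"
  define A1 where "A1 = {a \<in> W. \<exists>x\<in>X1. E x a}"
  define A2 where "A2 = {a \<in> W. \<exists>x\<in>X2. E x a}"
  have W: "W \<subseteq> {..<N}" "real N - 8 * real s \<le> card W"
    using card_outside[OF g] by (auto simp: W_def)
  have X: "X1 \<subseteq> {..<N}" "X2 \<subseteq> {..<N}" using grownD(1,2,4)[OF g] by auto
  have A: "6 * s \<le> card A1" "6 * s \<le> card A2"
    unfolding A1_def A2_def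
    using many_new_neighbours[OF X(1) grownD(10)[OF g] s W s2]
      many_new_neighbours[OF X(2) grownD(11)[OF g] s W s2] by auto
  have fW: "f a \<in> W" "f a \<noteq> a" if "a \<in> W" for a
    using grown_outside[OF f g] that unfolding W_def by auto
  note ff = matchingsD(1)[OF f]
  have inj: "inj_on f S" for S using matchingsD(6)[OF f] inj_on_subset by blast
  obtain D1 where D1: "D1 \<subseteq> A1" "card D1 = 2 * s"
    using obtain_subset_with_card_n[of "2 * s" A1] A(1) by auto
  have fin: "finite D1" using D1(2) s by (intro card_ge_0_finite) simp
  have "card (D1 \<union> f ` D1) \<le> 4 * s"
    using card_Un_le[of D1 "f ` D1"] D1(2) by (simp add: card_image inj)
  then have "2 * s \<le> card (A2 - (D1 \<union> f ` D1))"
    using diff_card_le_card_Diff[of "D1 \<union> f ` D1" A2] fin A(2) by simp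
  then obtain D2 where D2: "D2 \<subseteq> A2 - (D1 \<union> f ` D1)" "card D2 = 2 * s"
    by (rule obtain_subset_with_card_n)
  have DW: "D1 \<subseteq> W" "D2 \<subseteq> W" "f ` D1 \<subseteq> W" "f ` D2 \<subseteq> W"
    using D1(1) D2(1) fW by (auto simp: A1_def A2_def)
  have disj: "(D1 \<union> f ` D1) \<inter> (D2 \<union> f ` D2) = {}"
  proof -
    have "f b \<notin> D1 \<union> f ` D1" if "b \<in> D2" for b
      using that D2(1) ff by (metis DiffD2 UnCI UnE image_iff subsetD)
    then have "f ` D2 \<inter> (D1 \<union> f ` D1) = {}" by blast
    moreover have "D2 \<inter> (D1 \<union> f ` D1) = {}" using D2(1) by blast
    ultimately show ?thesis by blast
  qed
  \<comment> \<open>A side gains \<open>2 * s\<close> vertices and their \<open>2 * s\<close>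
    partners, so the ratio 4 in the invariant reproduces itself.\<close>
  have size: "card (V \<union> (D \<union> f ` D)) \<le> 4 * (2 * s)" if "card V \<le> 4 * s" "card D = 2 * s" for V D
    using card_Un_le[of V "D \<union> f ` D"] card_Un_le[of D "f ` D"] that by (simp add: card_image inj)
  have new: "reaches f (V \<union> (D \<union> f ` D)) (Suc t) (f a)"
    if X: "\<And>x. x \<in> X \<Longrightarrow> reaches f V t x" and V: "V \<subseteq> V1 \<union> V2"
      and D: "a \<in> D" "D \<subseteq> W" and ex: "\<exists>x\<in>X. E x a" for X V D a
  proof -
    obtain x where x: "x \<in> X" "E x a" using ex by auto
    have a: "a \<in> W" "f a \<in> W" "f a \<noteq> a" using D fW by auto
    then have "a \<notin> V" "f a \<notin> V" using V by (auto simp: W_def)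
    then show ?thesis
      using a(3) D(1) ff by (intro reaches_step[OF X[OF x(1)] x(2)]) auto
  qed
  have "grown f (Suc t) (2 * s) (f ` D1) (f ` D2) (V1 \<union> (D1 \<union> f ` D1)) (V2 \<union> (D2 \<union> f ` D2))"
    unfolding grown_def
  proof (intro conjI ballI)
    show "(V1 \<union> (D1 \<union> f ` D1)) \<inter> (V2 \<union> (D2 \<union> f ` D2)) = {}"
    proof -
      have "W \<inter> (V1 \<union> V2) = {}" by (auto simp: W_def)
      then show ?thesis using disj DW grownD(3)[OF g] by blast
    qed
    show "V1 \<union> (D1 \<union> f ` D1) \<union> (V2 \<union> (D2 \<union> f ` D2)) \<subseteq> {..<N}"
      using DW W(1) grownD(4)[OF g] by blast
    show "f ` (V1 \<union> (D1 \<union> f ` D1)) \<subseteq> V1 \<union> (D1 \<union> f ` D1)"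
      and "f ` (V2 \<union> (D2 \<union> f ` D2)) \<subseteq> V2 \<union> (D2 \<union> f ` D2)"
      using grownD(6,7)[OF g] ff by auto
    show "reaches f (V1 \<union> (D1 \<union> f ` D1)) (Suc t) x" if x: "x \<in> f ` D1" for x
    proof -
      obtain a where a: "a \<in> D1" "x = f a" using x by blast
      have "\<exists>x\<in>X1. E x a" using a(1) D1(1) by (auto simp: A1_def)
      then show ?thesis
        unfolding a(2) by (intro new[OF grownD(8)[OF g]] a(1) DW(1)) auto
    qed
    show "reaches f (V2 \<union> (D2 \<union> f ` D2)) (Suc t) x" if x: "x \<in> f ` D2" for x
    proof -
      obtain a where a: "a \<in> D2" "x = f a" using x by blast
      have "\<exists>x\<in>X2. E x a" using a(1) D2(1) by (auto simp: A2_def)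
      then show ?thesis
        unfolding a(2) by (intro new[OF grownD(9)[OF g]] a(1) DW(2)) auto
    qed
  qed (use size grownD(5,12,13)[OF g] D1(2) D2(2) in \<open>auto simp: card_image inj\<close>)
  then show ?thesis by blast
qed

lemma grown_exists:
  assumes f: "f \<in> matchings j" and j: "j \<ge> 1" and t: "real (2 ^ t * j) \<le> \<epsilon> * real n"
  shows "\<exists>X1 X2 V1 V2. grown f t (2 ^ t * j) X1 X2 V1 V2"
  using t
proof (induction t)
  case 0
  then show ?case using grown_start[OF f] by simp
next
  case (Suc t)
  \<comment> \<open>This is the condition \<open>4 * s \<le> \<epsilon> * N\<close> of
    \<open>grown_step\<close> for \<open>s = 2 ^ t * j\<close>.\<close>
  have le: "2 * real (2 ^ t * j) \<le> \<epsilon> * real n" using Suc.prems by simp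
  then have "real (2 ^ t * j) \<le> \<epsilon> * real n"
    using of_nat_0_le_iff[of "2 ^ t * j"] by linarith
  then obtain X1 X2 V1 V2 where "grown f t (2 ^ t * j) X1 X2 V1 V2" using Suc.IH by blast
  moreover have "2 ^ t * j \<ge> 1" using j by simp
  moreover have "4 * real (2 ^ t * j) \<le> \<epsilon> * real N" using le by (simp add: mult_ac)
  ultimately have "\<exists>X1 X2 V1 V2. grown f (Suc t) (2 * (2 ^ t * j)) X1 X2 V1 V2"
    by (rule grown_step[OF f])
  then show ?case by (simp add: mult.assoc)
qed

text \<open>\<open>G\<close> collects the outside vertices \<open>a\<close> such that
  \<open>a\<close> has a neighbour in \<open>X1\<close> and \<open>f a\<close> one in
  \<open>X2\<close>. Each is the middle of its own augmenting path, and expansion leaves few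
  exceptions.\<close>

lemma many_long_augmenting:
  assumes f: "f \<in> matchings j" and j: "j \<ge> 1"
    and t: "real (2 ^ t * j) \<le> \<epsilon> * real n" "\<epsilon> * real n \<le> 2 * real (2 ^ t * j)"
  shows "real N / 11 \<le> card (augmenting f (2 * t + 1))"
proof -
  define s where "s = 2 ^ t * j"
  obtain X1 X2 V1 V2 where g: "grown f t s X1 X2 V1 V2"
    using grown_exists[OF f j t(1)] s_def by blast
  define W where "W = {..<N} - (V1 \<union> V2)"
  define Y where "Y X = {a \<in> W. \<not> (\<exists>x\<in>X. E x a)}" for X
  define G where "G = W - (Y X1 \<union> f ` Y X2)"
  define m where "m = real N"
  have m: "m > 0" using n_pos by (simp add: m_def)
  have s0: "real s > 0" using j by (simp add: s_def)
  have W: "W \<subseteq> {..<N}" "finite W" "m - 8 * real s \<le> card W"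
    using card_outside[OF g] by (auto simp: W_def m_def)
  have X: "X1 \<subseteq> {..<N}" "X2 \<subseteq> {..<N}" using grownD(1,2,4)[OF g] by auto
  have Yb: "real (card (Y X)) \<le> (\<epsilon> * m)\<^sup>2 / s" if "X \<subseteq> {..<N}" "card X = s" for X
  proof -
    have "real s * card (Y X) \<le> \<epsilon>\<^sup>2 * (m * (m - card (Y X)))"
      using non_neighbours_bound[OF that(1) W(1)] unfolding that(2) Y_def m_def .
    also have "\<dots> \<le> \<epsilon>\<^sup>2 * (m * m)" using m by (intro mult_left_mono) auto
    finally show ?thesis using s0 by (simp add: field_simps power2_eq_square)
  qed
  have inj: "inj_on f S" for S using matchingsD(6)[OF f] inj_on_subset by blast
  have YW: "Y X \<subseteq> W" for X by (auto simp: Y_def)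
  have "card W - card (Y X1 \<union> f ` Y X2) \<le> card G"
    unfolding G_def by (rule diff_card_le_card_Diff) (use W(2) YW finite_subset in blast)
  moreover have "card (Y X1 \<union> f ` Y X2) \<le> card (Y X1) + card (Y X2)"
    using card_Un_le[of "Y X1" "f ` Y X2"] by (simp add: card_image inj)
  ultimately have "real (card W) - card (Y X1) - card (Y X2) \<le> card G" by linarith
  then have G1: "m - 8 * real s - 2 * ((\<epsilon> * m)\<^sup>2 / s) \<le> card G"
    using W(3) Yb[OF X(1) grownD(10)[OF g]] Yb[OF X(2) grownD(11)[OF g]] by linarith
  have bounds: "2 * real s \<le> \<epsilon> * m" "\<epsilon> * m \<le> 4 * real s" 
    using t unfolding s_def[symmetric] m_def by auto
  \<comment> \<open>Since \<open>\<epsilon> * m\<close> lies between \<open>s\<close> and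
    \<open>4 * s\<close>, this product linearizes the quadratic loss: in total at most
    \<open>10 * \<epsilon> * m\<close> vertices are lost, and \<open>\<epsilon> \<le> 1 / 11\<close>
    leaves \<open>m / 11\<close>.\<close>
  have "(\<epsilon> * m - 4 * real s) * (\<epsilon> * m - real s) \<le> 0"
    using bounds s0 by (intro mult_nonpos_nonneg) auto
  then have "8 * real s * real s + 2 * (\<epsilon> * m)\<^sup>2 \<le> 10 * (\<epsilon> * m) * real s"
    by (simp add: power2_eq_square algebra_simps)
  then have "8 * real s + 2 * ((\<epsilon> * m)\<^sup>2 / s) \<le> 10 * (\<epsilon> * m)"
    using s0 by (simp add: field_simps)
  moreover have "\<epsilon> * m \<le> 1 / 11 * m" using m eps_le by (intro mult_right_mono) auto
  ultimately have card_G: "m / 11 \<le> card G" using G1 by linarith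
  have "\<exists>P\<in>augmenting f (2 * t + 1). P ! (2 * t + 1) = a" if a: "a \<in> G" for a
  proof -
    have aW: "a \<in> W" using a by (simp add: G_def)
    then have fa: "f a \<in> W" "f a \<noteq> a" using grown_outside[OF f g] unfolding W_def by auto
    have ff: "f (f a) = a" by (rule matchingsD(1)[OF f])
    have "a \<notin> Y X1" "f a \<notin> Y X2"
      using a ff by (auto simp: G_def) (metis image_eqI)
    then obtain x1 x2 where x: "x1 \<in> X1" "E x1 a" "x2 \<in> X2" "E x2 (f a)"
      using aW fa by (auto simp: Y_def)
    show ?thesis
      by (rule reaches_join[OF grownD(8)[OF g x(1)] grownD(9)[OF g x(3)] grownD(3)[OF g] x(2,4)])
         (use aW fa ff in \<open>auto simp: W_def\<close>)
  qed
  then obtain p where p: "\<And>a. a \<in> G \<Longrightarrow> p a \<in> augmenting f (2 * t + 1) \<and> p a ! (2 * t + 1) = a"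
    by metis
  then have "inj_on p G" by (metis inj_onI)
  then have "card G \<le> card (augmenting f (2 * t + 1))"
    using p by (intro card_inj_on_le[of p]) (auto simp: finite_augmenting)
  with card_G show ?thesis by (simp add: m_def)
qed

end

section \<open>Counting\<close>

text \<open>Terms with \<open>j > q div 2\<close> vanish, and each remaining one exceeds by 1 its
  counterpart for \<open>q div 2\<close>, so induction applies. This controls the total path length
  in the descent.\<close>

lemma sum_floor_log_div_le: "(\<Sum>j=1..q. floor_log (q div j)) \<le> q"
proof (induction q rule: less_induct)
  case (less q)
  show ?case
  proof (cases "q = 0")
    case False
    let ?h = "q div 2"
    have "(\<Sum>j=1..q. floor_log (q div j)) = (\<Sum>j=1..?h. floor_log (q div j))"
    proof (rule sum.mono_neutral_right)
      show "\<forall>j\<in>{1..q} - {1..?h}. floor_log (q div j) = 0"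
      proof
        fix j assume "j \<in> {1..q} - {1..?h}"
        then have "q div j = 1" by (intro div_nat_eqI) auto
        then show "floor_log (q div j) = 0" by simp
      qed
    qed auto
    also have "\<dots> = (\<Sum>j=1..?h. Suc (floor_log (?h div j)))"
    proof (rule sum.cong)
      fix j assume "j \<in> {1..?h}"
      then have "2 * j \<le> q" "j > 0" by auto
      then have "q div j \<ge> 2" by (simp add: less_eq_div_iff_mult_less_eq)
      then have "floor_log (q div j) = Suc (floor_log (q div j div 2))" by (rule floor_log_rec)
      also have "q div j div 2 = ?h div j" by (simp add: div_mult2_eq[symmetric] mult.commute)
      finally show "floor_log (q div j) = Suc (floor_log (?h div j))" .
    qed simp
    also have "\<dots> = (\<Sum>j=1..?h. floor_log (?h div j)) + ?h" by (simp add: sum_Suc)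
    also have "\<dots> \<le> ?h + ?h" using less.IH[of ?h] False by simp
    also have "\<dots> \<le> q" by simp
    finally show ?thesis .
  qed simp
qed

text \<open>The left side divided by \<open>fact n\<close> is one term of the exponential series at
  \<open>n\<close>.\<close>

lemma power_le_exp_fact: "real n ^ n \<le> exp (real n) * fact n"
proof -
  have "(\<Sum>k\<in>{n}. real n ^ k /\<^sub>R fact k) \<le> (\<Sum>k. real n ^ k /\<^sub>R fact k)"
    by (intro sum_le_suminf sums_summable[OF exp_converges]) auto
  also have "\<dots> = exp (real n)" by (rule sums_unique[OF exp_converges, symmetric])
  finally have "real n ^ n / fact n \<le> exp (real n)" by (simp add: field_simps)
  then show ?thesis by (simp add: pos_divide_le_eq)
qed

text \<open>The base splits into three factors, whose powers pay separately:
  \<open>\<epsilon> / exp 1 ^ 3\<close> for the constant 2, \<open>1 / 2\<close> for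
  \<open>2 ^ q\<close>, and \<open>1 / d ^ 6\<close> for the power of \<open>d\<close>.\<close>

lemma expander_factor_bound:
  fixes d x \<epsilon> :: real
  assumes d: "d \<ge> 1" and \<epsilon>: "0 < \<epsilon>" "\<epsilon> \<le> 1 / 4" and x: "1 / 2 \<le> x" "real q \<le> x"
  shows "(\<epsilon> / (2 * exp 1 ^ 3 * d ^ 6)) powr x \<le> 1 / (2 * 2 ^ q * d ^ (4 * q + 1))"
proof -
  have e3: "(1::real) \<le> exp 1 ^ 3" by (intro one_le_power) simp
  have d0: "d > 0" using d by simp
  have "\<epsilon> / (2 * exp 1 ^ 3 * d ^ 6) = (\<epsilon> / exp 1 ^ 3) * ((1 / 2) * (1 / d ^ 6))" by simp
  then have "(\<epsilon> / (2 * exp 1 ^ 3 * d ^ 6)) powr x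
      = (\<epsilon> / exp 1 ^ 3) powr x * ((1 / 2) powr x * (1 / d ^ 6) powr x)"
    using \<epsilon> d0 by (simp only: powr_mult)
  also have "\<dots> \<le> 1 / 2 * (1 / 2 ^ q * (1 / d ^ (4 * q + 1)))"
  proof (intro mult_mono)
    have "\<epsilon> / exp 1 ^ 3 \<le> 1 / 4"
    proof -
      have "\<epsilon> \<le> 1 / 4 * exp 1 ^ 3" using \<epsilon>(2) e3 by linarith
      then show ?thesis by (simp add: pos_divide_le_eq)
    qed
    then have "(\<epsilon> / exp 1 ^ 3) powr x \<le> (1 / 4) powr x" using \<epsilon> x by (intro powr_mono2) auto
    also have "\<dots> \<le> (1 / 4) powr (1 / 2)" using x by (intro powr_mono') auto
    also have "\<dots> = 1 / 2" by (simp add: powr_half_sqrt real_sqrt_divide)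
    finally show "(\<epsilon> / exp 1 ^ 3) powr x \<le> 1 / 2" .
    have "(1 / 2 :: real) powr x \<le> (1 / 2) powr (real q)" using x by (intro powr_mono') auto
    also have "\<dots> = 1 / 2 ^ q" by (simp add: powr_realpow power_one_over)
    finally show "(1 / 2 :: real) powr x \<le> 1 / 2 ^ q" .
    have "(1 / d ^ 6) powr x = d powr (- (6 * x))"
    proof -
      have "1 / d ^ 6 = d powr (- 6)" using d0 by (simp add: powr_minus divide_inverse)
      then show ?thesis by (simp add: powr_powr)
    qed
    \<comment> \<open>Of \<open>6 * x\<close>, the part \<open>4 * x\<close> covers
      \<open>4 * q\<close> and the part \<open>2 * x\<close> covers 1.\<close>
    also have "\<dots> \<le> d powr (- real (4 * q + 1))" using x d by (intro powr_mono) auto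
    also have "\<dots> = 1 / d ^ (4 * q + 1)"
      unfolding powr_minus using d0 by (simp only: powr_realpow) (simp add: divide_inverse)
    finally show "(1 / d ^ 6) powr x \<le> 1 / d ^ (4 * q + 1)" .
  qed (use d0 in auto)
  also have "\<dots> = 1 / (2 * 2 ^ q * d ^ (4 * q + 1))" by simp
  finally show ?thesis .
qed

section \<open>The greedy phase, the descent and the final estimate\<close>

context regular_expander
begin

abbreviation num :: "nat \<Rightarrow> real" where "num j \<equiv> real (card (matchings j))"

text \<open>The second bound is integrality: a positive count is at least 1. It serves when
  \<open>i\<close> exceeds \<open>\<epsilon> * n\<close> too narrowly for the first to be
  useful.\<close>

lemma unmatched_edges_bound:
  assumes f: "f \<in> matchings i"
  shows "2 * real d * real i * (real i - \<epsilon> * real n) / real n \<le> real (card (augmenting f 0))"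
    and "\<epsilon> * real n < real i \<Longrightarrow> 1 \<le> real (card (augmenting f 0))"
proof -
  have n0: "real n > 0" using n_pos by simp
  let ?e = "real (card (edge_pairs (unmatched f) (unmatched f)))"
  have "unmatched f \<subseteq> {..<N}" by (auto simp: unmatched_def)
  from internal_edges_bound[OF this]
  have "d * (2 * real i) * (2 * real i / N - \<epsilon> * (1 - 2 * real i / N)) \<le> ?e"
    using matchingsD(3)[OF f] by simp
  moreover have "2 * real d * real i * (real i - \<epsilon> * real n) / real n + 2 * real d * real i * (\<epsilon> * real i) / real n
      = d * (2 * real i) * (2 * real i / N - \<epsilon> * (1 - 2 * real i / N))"
    using n0 by (simp add: field_simps)
  moreover have "0 \<le> 2 * real d * real i * (\<epsilon> * real i) / real n" using eps_pos by simp
  ultimately have e: "2 * real d * real i * (real i - \<epsilon> * real n) / real n \<le> ?e" by linarith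
  moreover have le: "?e \<le> real (card (augmenting f 0))" using card_augmenting_0_ge by simp
  ultimately show "2 * real d * real i * (real i - \<epsilon> * real n) / real n \<le> real (card (augmenting f 0))"
    by linarith
  assume lt: "\<epsilon> * real n < real i"
  moreover have "0 \<le> \<epsilon> * real n" using eps_pos by simp
  ultimately have "0 < 2 * real d * real i * (real i - \<epsilon> * real n) / real n"
    using d_pos n0 by simp
  then show "1 \<le> real (card (augmenting f 0))" using e le by simp
qed

text \<open>Downward induction from the empty matching. Replacing \<open>\<epsilon> * n\<close> by
  the integer \<open>q + 1\<close> turns the product of the step factors
  \<open>(d / n) * (j + 1) * (j - q) / (n - j)\<close> into factorials.\<close>

lemma greedy_bound:
  assumes q: "\<epsilon> * real n < real q + 1" and j: "q + 1 \<le> j" "j \<le> n"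
  shows "(real d / real n) ^ (n - j) * (fact n * fact (n - q - 1))
     / (fact j * fact (j - q - 1) * fact (n - j)) \<le> num j"
  using j(2,1)
proof (induction rule: inc_induct)
  case base
  have "card (matchings n) > 0" using id_matching finite_matchings card_gt_0_iff by blast
  then show ?case by simp
next
  case (step j)
  have n0: "real n > 0" using n_pos by simp
  define c where "c = 2 * real d * real (Suc j) * (real (Suc j) - real q - 1) / real n"
  have c0: "c \<ge> 0" using step by (simp add: c_def)
  have "c \<le> real (card (augmenting f 0))" if "f \<in> matchings (Suc j)" for f
  proof -
    have "c \<le> 2 * real d * real (Suc j) * (real (Suc j) - \<epsilon> * real n) / real n"
      unfolding c_def using q by (intro divide_right_mono mult_left_mono) auto
    then show ?thesis using unmatched_edges_bound(1)[OF that] by linarith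
  qed
  then have main: "num (Suc j) * c \<le> num j * ((real N - 2 * real j) * real d ^ 0)"
    using step by (intro augmenting_step) auto
  define A where "A = (real d / real n) ^ (n - Suc j) * (fact n * fact (n - q - 1))
     / (fact (Suc j) * fact (Suc j - q - 1) * fact (n - Suc j))"
  have IH: "A \<le> num (Suc j)" using step by (simp add: A_def)
  obtain b where b: "j = q + 1 + b" using step le_Suc_ex by blast
  obtain a where a: "n = Suc j + a" using step less_imp_Suc_add by (metis add_Suc)
  define F :: real where "F = fact n * fact (n - q - 1)"
  define r where "r = real d / real n"
  define T where "T = r ^ Suc a * F / (fact j * fact b * fact (Suc a))"
  have A': "A = r ^ a * F / ((real (Suc j) * fact j) * (real (Suc b) * fact b) * fact a)"
    using a b by (simp add: A_def F_def r_def)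
  have c': "c = 2 * r * real (Suc j) * real (Suc b)"
    using b by (simp add: c_def r_def)
  have "T * (2 * real (Suc a)) = 2 * (r ^ Suc a * F / (fact j * fact b * fact a))"
    by (simp add: T_def field_simps del: of_nat_Suc)
  also have "\<dots> = A * c" unfolding A' c' by (simp add: field_simps del: of_nat_Suc)
  also have "\<dots> \<le> num (Suc j) * c" using IH c0 by (rule mult_right_mono)
  also have "\<dots> \<le> num j * (2 * real (Suc a))" using main a by (simp add: algebra_simps)
  finally have "T \<le> num j" by simp
  moreover have "n - j = Suc a" "j - q - 1 = b" using a b by auto
  ultimately show ?case by (simp add: T_def F_def r_def)
qed

text \<open>In the last step, from \<open>q + 1\<close> to \<open>q\<close>, the factor
  \<open>i - q - 1\<close> would vanish, so only one augmenting edge is guaranteed; this costs at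
  most \<open>2 * n\<close>.\<close>

lemma greedy_end:
  assumes q: "real q \<le> \<epsilon> * real n" "\<epsilon> * real n < real q + 1"
  shows "(real d / real n) ^ (n - q - 1) * fact n / (fact (q + 1) * (2 * real n)) \<le> num q"
proof -
  have "\<epsilon> * real n < real n" using eps_lt_one n_pos by simp
  then have qn: "q + 1 \<le> n" using q(1) by linarith
  have "(real d / real n) ^ (n - (q + 1)) * (fact n * fact (n - q - 1))
     / (fact (q + 1) * fact (q + 1 - q - 1) * fact (n - (q + 1))) \<le> num (q + 1)"
    by (rule greedy_bound[OF q(2) order_refl qn])
  then have "(real d / real n) ^ (n - q - 1) * fact n / fact (q + 1) \<le> num (Suc q)"
    by (simp del: fact_Suc)
  also have "\<dots> = num (Suc q) * 1" by simp
  also have "\<dots> \<le> num q * ((real N - 2 * real q) * real d ^ 0)"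
    using unmatched_edges_bound(2)[of _ "Suc q"] q qn by (intro augmenting_step) auto
  also have "\<dots> \<le> num q * (2 * real n)" by (intro mult_left_mono) auto
  finally have "(real d / real n) ^ (n - q - 1) * fact n / fact (q + 1) / (2 * real n) \<le> num q"
    using n_pos by (subst pos_divide_le_eq) auto
  then show ?thesis by (simp only: divide_divide_eq_left)
qed

text \<open>\<open>floor_log (q div j)\<close> is the largest \<open>t\<close> with
  \<open>2 ^ t * j \<le> q\<close>. The factor 11 is the ratio of at most \<open>N\<close> starting
  vertices to at least \<open>N / 11\<close> paths.\<close>

lemma augmenting_descent:
  assumes q: "real q \<le> \<epsilon> * real n" "\<epsilon> * real n < real q + 1" and i: "i \<le> q"
  shows "num i \<le> num 0 * (11 ^ i * real d ^ (\<Sum>j=1..i. 2 * floor_log (q div j) + 1))"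
  using i
proof (induction i)
  case (Suc i)
  define t where "t = floor_log (q div Suc i)"
  have pos: "q div Suc i > 0" using Suc.prems by (simp add: div_greater_zero_iff)
  have "2 ^ t * Suc i \<le> q"
    using floor_log_exp2_le[OF pos] by (simp add: t_def less_eq_div_iff_mult_less_eq)
  then have "real (2 ^ t * Suc i) \<le> real q" by (simp only: of_nat_le_iff)
  then have t1: "real (2 ^ t * Suc i) \<le> \<epsilon> * real n" using q(1) by linarith
  have "q < 2 * (2 ^ t * Suc i)"
    using floor_log_exp2_gt[of "q div Suc i"] by (simp add: t_def div_less_iff_less_mult mult.assoc)
  \<comment> \<open>Integrality yields the extra 1 that lifts the bound from \<open>q\<close> to
    \<open>\<epsilon> * n\<close>.\<close>
  then have "real q + 1 \<le> 2 * real (2 ^ t * Suc i)" by linarith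
  then have t2: "\<epsilon> * real n \<le> 2 * real (2 ^ t * Suc i)" using q(2) by linarith
  have qn: "real q \<le> real n"
    using q(1) eps_lt_one mult_right_mono[of \<epsilon> 1 "real n"] by linarith
  have "num (Suc i) * (real N / 11) \<le> num i * ((real N - 2 * real i) * real d ^ (2 * t + 1))"
    using many_long_augmenting[OF _ _ t1 t2] Suc.prems qn by (intro augmenting_step) auto
  also have "\<dots> \<le> num i * (real N * real d ^ (2 * t + 1))"
    by (intro mult_left_mono mult_right_mono) auto
  finally have "num (Suc i) * (real N / 11) \<le> (num i * (11 * real d ^ (2 * t + 1))) * (real N / 11)"
    by (simp add: mult_ac)
  then have "num (Suc i) \<le> num i * (11 * real d ^ (2 * t + 1))"
    by (rule mult_right_le_imp_le) (use n_pos in simp)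
  also have "\<dots> \<le> num 0 * (11 ^ i * real d ^ (\<Sum>j=1..i. 2 * floor_log (q div j) + 1))
      * (11 * real d ^ (2 * t + 1))"
    using Suc by (intro mult_right_mono) auto
  also have "\<dots> = num 0 * (11 ^ Suc i * real d ^ (\<Sum>j=1..Suc i. 2 * floor_log (q div j) + 1))"
    by (simp add: power_add t_def mult_ac)
  finally show ?case .
qed simp

lemma num_perfect_bound:
  "(real d / exp 1) ^ n * (\<epsilon> / (2 * exp 1 ^ 3 * real d ^ 6)) powr (\<epsilon> * real n) \<le> num 0"
proof -
  define x where "x = \<epsilon> * real n"
  define q where "q = nat \<lfloor>x\<rfloor>"
  have n0: "real n > 0" and d1: "real d \<ge> 1" using n_pos d_pos by auto
  have x0: "x \<ge> 0" using eps_pos by (simp add: x_def)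
  have x1: "1 / 2 \<le> x" using eps_N_ge_1 by (simp add: x_def)
  have q: "real q \<le> x" "x < real q + 1" using x0 by (auto simp: q_def)
  have "x \<le> 1 / 11 * real n" unfolding x_def using eps_le by (intro mult_right_mono) auto
  then have q11: "11 * real q \<le> real n" using q by linarith
  then have qn: "q + 1 \<le> n" using n_pos by linarith
  have "(\<Sum>j=1..q. 2 * floor_log (q div j) + 1) = 2 * (\<Sum>j=1..q. floor_log (q div j)) + q"
    by (simp add: sum_Suc sum_distrib_left)
  then have expo: "(\<Sum>j=1..q. 2 * floor_log (q div j) + 1) \<le> 3 * q"
    using sum_floor_log_div_le[of q] by linarith
  have "num q \<le> num 0 * (11 ^ q * real d ^ (\<Sum>j=1..q. 2 * floor_log (q div j) + 1))"
    using q by (intro augmenting_descent) (auto simp: x_def)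
  also have "\<dots> \<le> num 0 * (11 ^ q * real d ^ (3 * q))"
    using expo d1 by (intro mult_left_mono power_increasing) auto
  finally have up: "num q \<le> num 0 * (11 ^ q * real d ^ (3 * q))" .
  define B where "B = (real d / exp 1) ^ n"
  have B0: "B \<ge> 0" by (simp add: B_def)
  \<comment> \<open>The exponent \<open>4 * q + 1\<close> combines \<open>3 * q\<close> from the
    descent with \<open>q + 1\<close> edges missing from the greedy phase.\<close>
  have "B * (1 / (2 * 2 ^ q * real d ^ (4 * q + 1))) * (11 ^ q * real d ^ (3 * q))
      = B * (11 ^ q / (2 ^ q * (2 * real d ^ (q + 1))))"
    using d1 by (simp add: field_simps power_add power_mult power3_eq_cube power4_eq_xxxx)
  also have "\<dots> \<le> B * (real n ^ q / (fact (q + 1) * (2 * real d ^ (q + 1))))"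
  proof (intro mult_left_mono B0)
    have "real (q + 1) \<le> 2 ^ q"
      using less_exp[of q] by (metis Suc_eq_plus1 Suc_leI of_nat_le_iff of_nat_numeral of_nat_power)
    moreover have "11 ^ q * fact q \<le> real n ^ q"
    proof -
      have "11 ^ q * fact q \<le> 11 ^ q * real q ^ q"
        using fact_le_power[of q, where 'a = real] by (intro mult_left_mono) auto
      also have "\<dots> = (11 * real q) ^ q" by (simp add: power_mult_distrib)
      also have "\<dots> \<le> real n ^ q" using q11 by (intro power_mono) auto
      finally show ?thesis .
    qed
    \<comment> \<open>The powers of 11 are absorbed by \<open>n ^ q\<close>, because
      \<open>11 * q \<le> n\<close>; the factor \<open>2 ^ q\<close> pays for
      \<open>q + 1\<close>.\<close>
    ultimately have "(11 ^ q * fact q) * real (q + 1) \<le> real n ^ q * 2 ^ q"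
      by (intro mult_mono) auto
    then have "11 ^ q * fact (q + 1) \<le> real n ^ q * 2 ^ q" by (simp add: algebra_simps)
    then have "11 ^ q / 2 ^ q \<le> real n ^ q / fact (q + 1)"
      by (simp add: pos_divide_le_eq pos_le_divide_eq del: fact_Suc)
    then have "11 ^ q / 2 ^ q / (2 * real d ^ (q + 1)) \<le> real n ^ q / fact (q + 1) / (2 * real d ^ (q + 1))"
      by (intro divide_right_mono) auto
    then show "11 ^ q / (2 ^ q * (2 * real d ^ (q + 1))) \<le> real n ^ q / (fact (q + 1) * (2 * real d ^ (q + 1)))"
      by (simp only: divide_divide_eq_left)
  qed
  also have "\<dots> \<le> (real d / real n) ^ n * fact n * (real n ^ q / (fact (q + 1) * (2 * real d ^ (q + 1))))"
  proof (rule mult_right_mono)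
    have "B = (real d / real n) ^ n * (real n ^ n / exp (real n))"
      using n0 by (simp add: B_def power_divide exp_of_nat_mult[symmetric])
    also have "\<dots> \<le> (real d / real n) ^ n * fact n"
      using power_le_exp_fact[of n] by (intro mult_left_mono) (auto simp: pos_divide_le_eq mult.commute)
    finally show "B \<le> (real d / real n) ^ n * fact n" .
  qed simp
  also have "(real d / real n) ^ n = (real d / real n) ^ (n - q - 1) * (real d / real n) ^ (q + 1)"
    using qn by (simp only: power_add[symmetric]) simp
  also have "(real d / real n) ^ (n - q - 1) * (real d / real n) ^ (q + 1) * fact n
        * (real n ^ q / (fact (q + 1) * (2 * real d ^ (q + 1))))
      = (real d / real n) ^ (n - q - 1) * fact n / (fact (q + 1) * (2 * real n))"
  proof -
    have cancel: "(real d / real n) ^ (q + 1) * (real n ^ q / (2 * real d ^ (q + 1))) = 1 / (2 * real n)"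
      using d1 n0 by (simp add: power_divide)
    have regroup: "X * a * Y * (b / (Z * c)) = X * Y / Z * (a * (b / c))" for X Y Z a b c :: real
      by (simp add: divide_inverse mult_ac)
    show ?thesis
      unfolding regroup cancel by (simp only: times_divide_eq_right mult_1_right divide_divide_eq_left)
  qed
  also have "\<dots> \<le> num q" using q by (intro greedy_end) (auto simp: x_def)
  also note up
  finally have low: "B * (1 / (2 * 2 ^ q * real d ^ (4 * q + 1))) \<le> num 0"
    by (rule mult_right_le_imp_le) (use d1 in simp)
  have "B * (\<epsilon> / (2 * exp 1 ^ 3 * real d ^ 6)) powr x \<le> B * (1 / (2 * 2 ^ q * real d ^ (4 * q + 1)))"
    using expander_factor_bound[OF d1 eps_pos _ x1 q(1)] eps_le by (intro mult_left_mono B0) auto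
  with low show ?thesis by (simp add: B_def x_def)
qed

end

theorem theorem1p4:
  fixes n d :: nat and E :: "nat \<Rightarrow> nat \<Rightarrow> bool" and \<epsilon> :: real
  assumes "n \<ge> 1" and "d \<ge> 1"
    and "0 < \<epsilon>" and "\<epsilon> \<le> 1 / 11"
    and "simple_graph (2 * n) E"
    and "regular (2 * n) E d"
    and "spectral_expander (2 * n) E \<epsilon>"
  shows "real (num_perfect_matchings (2 * n) E) \<ge>
           (real d / exp 1) ^ n * (\<epsilon> / (2 * exp 1 ^ 3 * real d ^ 6)) powr (\<epsilon> * real n)"
proof -
  interpret regular_expander n d E \<epsilon> by unfold_locales (fact assms)+
  show ?thesis using num_perfect_bound card_matchings_0_le by linarith
qed

end
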